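(* For the two-hop, two-user interference channel described in the context, the degrees of freedom under each of the four feedback models satisfy \[ \mathbf{d}^{\rm dCSI}\le \tfrac{4}{3},\qquad \mathbf{d}^{\rm op\text{-}fb}\le \tfrac{4}{3},\qquad \mathbf{d}^{\rm lS}\le \tfrac{4}{3},\qquad \mathbf{d}^{\rm S}\le \tfrac{4}{3}. \]
   Context: Two-hop, two-user interference channel ($2\times2\times2$ network): sources $S_1,S_2$, relays $R_1,R_2$, destinations $D_1,D_2$. At channel use $t$, $Y_{R_i}(t)=H_{i1}(t)X_{S_1}(t)+H_{i2}(t)X_{S_2}(t)+Z_{R_i}(t)$ and $Y_{D_i}(t)=G_{i1}(t)X_{R_1}(t)+G_{i2}(t)X_{R_2}(t)+Z_{D_i}(t)$, $i=1,2$, where all signals are complex, each transmitted signal $X_{S_i}, X_{R_i}$ satisfies power constraint $P$, and all $H_{ij}(t),G_{ij}(t),Z_{R_i}(t),Z_{D_i}(t)$ are i.i.d. $\mathcal{CN}(0,1)$ across $i,j,t$. All nodes know the channel distribution. Relays transmit causally functions of their past received signals (and whatever side information they have). Both destinations know all channel coefficients $\{H_{ij}(t),G_{ij}(t)\}$ (instantaneously). Source $S_i$ has message $\mathcal{M}_i$ at rate $r_i$ intended for $D_i$; $(r_1,r_2)$ is achievable if the average decoding error probability at each destination tends to zero as blocklength grows. $C_{\rm sum}(P)$ is the maximum achievable sum rate and the degrees of freedom are $\mathbf{d}=\lim_{P\to\infty}C_{\rm sum}(P)/\log_2 P$. Feedback models (delays of one time unit, without loss of generality): (1) Delayed CSI-S: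 at time $t+1$ the sources know $\{H_{ij}(t),G_{ij}(t)\}_{i,j}$; relays have no side information. DoF denoted $\mathbf{d}^{\rm dCSI}$. (2) Output feedback: for each $i$, $S_i$ knows $Y_{R_i}(t)$ at time $t+1$ and $R_i$ knows $Y_{D_i}(t)$ at time $t+1$; relays also know the first-hop coefficients $\{H_{ij}(t)\}$ instantaneously. DoF denoted $\mathbf{d}^{\rm op\text{-}fb}$. (3) Shannon feedback: at time $t+1$ the sources know $\{H_{ij}(t),G_{ij}(t)\}_{i,j}$ and $\{Y_{R_i}(t),Y_{D_i}(t)\}_i$; the relays know $\{G_{ij}(t)\}$ and $\{Y_{D_i}(t)\}$ at time $t+1$, and the first-hop coefficients instantaneously. DoF denoted $\mathbf{d}^{\rm S}$. (4) Limited Shannon feedback: both relays know $\{G_{ij}(t)\}$ at time $t+1$, relay $R_i$ knows $Y_{D_i}(t)$ at time $t+1$, relays know first-hop coefficients instantaneously; sources have no side information. DoF denoted $\mathbf{d}^{\rm lS}$. *)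

theory Defs
  imports "HOL-Probability.Probability"
begin

(* Users / relays / destinations are indexed 0 and 1 (paper's 1 and 2).
   Per time slot s the randomness consists of 12 complex numbers:
   index 2*i+j      : H_{ij}(s)
   index 4+2*i+j    : G_{ij}(s)
   index 8+i        : Z_{R_i}(s)
   index 10+i       : Z_{D_i}(s)
   A sample omega maps (s, index) to the value. *)

datatype fb_model = DelayedCSI | OutputFB | ShannonFB | LimitedShannonFB

(* circularly symmetric complex Gaussian CN(0,1): independent real and
   imaginary parts, each N(0,1/2) *)
definition CN01 :: "complex measure" where
  "CN01 = distr (density lborel (normal_density 0 (sqrt (1/2)))
                  \<Otimes>\<^sub>M density lborel (normal_density 0 (sqrt (1/2))))
                borel (\<lambda>(a, b). Complex a b)"

definition noiseM :: "nat \<Rightarrow> (nat \<times> nat \<Rightarrow> complex) measure" where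
  "noiseM n = (\<Pi>\<^sub>M p \<in> {..<n} \<times> {..<12}. CN01)"

definition Hc :: "(nat \<times> nat \<Rightarrow> complex) \<Rightarrow> nat \<Rightarrow> nat \<Rightarrow> nat \<Rightarrow> complex" where
  "Hc \<omega> s i j = \<omega> (s, 2 * i + j)"
definition Gc :: "(nat \<times> nat \<Rightarrow> complex) \<Rightarrow> nat \<Rightarrow> nat \<Rightarrow> nat \<Rightarrow> complex" where
  "Gc \<omega> s i j = \<omega> (s, 4 + 2 * i + j)"
definition ZR :: "(nat \<times> nat \<Rightarrow> complex) \<Rightarrow> nat \<Rightarrow> nat \<Rightarrow> complex" where
  "ZR \<omega> s i = \<omega> (s, 8 + i)"
definition ZD :: "(nat \<times> nat \<Rightarrow> complex) \<Rightarrow> nat \<Rightarrow> nat \<Rightarrow> complex" where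
  "ZD \<omega> s i = \<omega> (s, 10 + i)"

(* x = transmitted symbols at slot s: x 0 = X_{S_1}, x 1 = X_{S_2}, x 2 = X_{R_1}, x 3 = X_{R_2} *)
definition yR :: "(nat \<times> nat \<Rightarrow> complex) \<Rightarrow> (nat \<Rightarrow> complex) \<Rightarrow> nat \<Rightarrow> nat \<Rightarrow> complex" where
  "yR \<omega> x s i = Hc \<omega> s i 0 * x 0 + Hc \<omega> s i 1 * x 1 + ZR \<omega> s i"
definition yD :: "(nat \<times> nat \<Rightarrow> complex) \<Rightarrow> (nat \<Rightarrow> complex) \<Rightarrow> nat \<Rightarrow> nat \<Rightarrow> complex" where
  "yD \<omega> x s i = Gc \<omega> s i 0 * x 2 + Gc \<omega> s i 1 * x 3 + ZD \<omega> s i"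

definition chH :: "(nat \<times> nat \<Rightarrow> complex) \<Rightarrow> nat \<Rightarrow> complex list" where
  "chH \<omega> s = [Hc \<omega> s 0 0, Hc \<omega> s 0 1, Hc \<omega> s 1 0, Hc \<omega> s 1 1]"
definition chG :: "(nat \<times> nat \<Rightarrow> complex) \<Rightarrow> nat \<Rightarrow> complex list" where
  "chG \<omega> s = [Gc \<omega> s 0 0, Gc \<omega> s 0 1, Gc \<omega> s 1 0, Gc \<omega> s 1 1]"

definition past :: "(nat \<Rightarrow> complex list) \<Rightarrow> nat \<Rightarrow> complex list" where
  "past f t = concat (map f [0..<t])"

(* side information of source i when transmitting at slot t;
   hs = list of transmitted symbol vectors at slots 0..t-1 *)
definition src_view :: "fb_model \<Rightarrow> nat \<Rightarrow> (nat \<times> nat \<Rightarrow> complex) \<Rightarrow> (nat \<Rightarrow> complex) list \<Rightarrow> nat \<Rightarrow> complex list" where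
  "src_view m i \<omega> hs t = (case m of
      DelayedCSI \<Rightarrow> past (\<lambda>s. chH \<omega> s @ chG \<omega> s) t
    | OutputFB \<Rightarrow> past (\<lambda>s. [yR \<omega> (hs ! s) s i]) t
    | ShannonFB \<Rightarrow> past (\<lambda>s. chH \<omega> s @ chG \<omega> s @
          [yR \<omega> (hs ! s) s 0, yR \<omega> (hs ! s) s 1, yD \<omega> (hs ! s) s 0, yD \<omega> (hs ! s) s 1]) t
    | LimitedShannonFB \<Rightarrow> [])"

(* what relay i knows when transmitting at slot t: its past received signals,
   plus side information (first-hop coefficients instantaneously, i.e. up to slot t) *)
definition rel_view :: "fb_model \<Rightarrow> nat \<Rightarrow> (nat \<times> nat \<Rightarrow> complex) \<Rightarrow> (nat \<Rightarrow> complex) list \<Rightarrow> nat \<Rightarrow> complex list" where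
  "rel_view m i \<omega> hs t = past (\<lambda>s. [yR \<omega> (hs ! s) s i]) t @ (case m of
      DelayedCSI \<Rightarrow> []
    | OutputFB \<Rightarrow> past (chH \<omega>) (Suc t) @ past (\<lambda>s. [yD \<omega> (hs ! s) s i]) t
    | ShannonFB \<Rightarrow> past (chH \<omega>) (Suc t) @
          past (\<lambda>s. chG \<omega> s @ [yD \<omega> (hs ! s) s 0, yD \<omega> (hs ! s) s 1]) t
    | LimitedShannonFB \<Rightarrow> past (chH \<omega>) (Suc t) @
          past (\<lambda>s. chG \<omega> s @ [yD \<omega> (hs ! s) s i]) t)"

record code =
  msz :: "nat \<Rightarrow> nat"
  enc_src :: "nat \<Rightarrow> nat \<Rightarrow> nat \<Rightarrow> complex list \<Rightarrow> complex"   (* i t message view *)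
  enc_rel :: "nat \<Rightarrow> nat \<Rightarrow> complex list \<Rightarrow> complex"           (* i t view *)
  dec :: "nat \<Rightarrow> complex list \<Rightarrow> nat"                          (* i view *)

definition step :: "code \<Rightarrow> fb_model \<Rightarrow> (nat \<Rightarrow> nat) \<Rightarrow> (nat \<times> nat \<Rightarrow> complex) \<Rightarrow> nat \<Rightarrow> (nat \<Rightarrow> complex) list \<Rightarrow> nat \<Rightarrow> complex" where
  "step c m w \<omega> t hs = (\<lambda>k. if k < 2 then enc_src c k t (w k) (src_view m k \<omega> hs t)
                          else if k < 4 then enc_rel c (k - 2) t (rel_view m (k - 2) \<omega> hs t)
                          else 0)"

fun hist :: "code \<Rightarrow> fb_model \<Rightarrow> (nat \<Rightarrow> nat) \<Rightarrow> (nat \<times> nat \<Rightarrow> complex) \<Rightarrow> nat \<Rightarrow> (nat \<Rightarrow> complex) list" where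
  "hist c m w \<omega> 0 = []"
| "hist c m w \<omega> (Suc t) = hist c m w \<omega> t @ [step c m w \<omega> t (hist c m w \<omega> t)]"

definition Xsig :: "code \<Rightarrow> fb_model \<Rightarrow> (nat \<Rightarrow> nat) \<Rightarrow> (nat \<times> nat \<Rightarrow> complex) \<Rightarrow> nat \<Rightarrow> nat \<Rightarrow> complex" where
  "Xsig c m w \<omega> t = hist c m w \<omega> (Suc t) ! t"

definition dest_view :: "code \<Rightarrow> fb_model \<Rightarrow> (nat \<Rightarrow> nat) \<Rightarrow> (nat \<times> nat \<Rightarrow> complex) \<Rightarrow> nat \<Rightarrow> nat \<Rightarrow> complex list" where
  "dest_view c m w \<omega> n i = past (\<lambda>s. [yD \<omega> (Xsig c m w \<omega> s) s i]) n @ past (\<lambda>s. chH \<omega> s @ chG \<omega> s) n"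

definition msgs :: "code \<Rightarrow> (nat \<Rightarrow> nat) set" where
  "msgs c = (\<lambda>(w1, w2). (\<lambda>k. if k = 0 then w1 else w2)) ` ({..<msz c 0} \<times> {..<msz c 1})"

definition valid_code :: "fb_model \<Rightarrow> real \<Rightarrow> nat \<Rightarrow> code \<Rightarrow> bool" where
  "valid_code m P n c \<longleftrightarrow> n > 0 \<and> msz c 0 \<ge> 1 \<and> msz c 1 \<ge> 1 \<and>
     (\<forall>w \<in> msgs c.
        (\<forall>t<n. \<forall>k<4. (\<lambda>\<omega>. Xsig c m w \<omega> t k) \<in> borel_measurable (noiseM n)) \<and>
        (\<forall>i<2. {\<omega> \<in> space (noiseM n). dec c i (dest_view c m w \<omega> n i) = w i} \<in> sets (noiseM n))) \<and>
     (\<forall>k<4. (\<Sum>t<n. \<Sum>w\<in>msgs c. \<integral>\<^sup>+ \<omega>. ennreal ((cmod (Xsig c m w \<omega> t k))\<^sup>2) \<partial>noiseM n)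
              \<le> ennreal (P * real n * real (msz c 0) * real (msz c 1)))"

definition err :: "fb_model \<Rightarrow> nat \<Rightarrow> code \<Rightarrow> nat \<Rightarrow> real" where
  "err m n c i = (\<Sum>w\<in>msgs c. measure (noiseM n)
        {\<omega> \<in> space (noiseM n). dec c i (dest_view c m w \<omega> n i) \<noteq> w i})
      / (real (msz c 0) * real (msz c 1))"

definition achievable :: "fb_model \<Rightarrow> real \<Rightarrow> real \<Rightarrow> real \<Rightarrow> bool" where
  "achievable m P r1 r2 \<longleftrightarrow> r1 \<ge> 0 \<and> r2 \<ge> 0 \<and>
     (\<forall>\<epsilon>>0. \<exists>N. \<forall>n\<ge>N. \<exists>c. valid_code m P n c \<and>
        real (msz c 0) \<ge> 2 powr (real n * r1) \<and> real (msz c 1) \<ge> 2 powr (real n * r2) \<and>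
        err m n c 0 \<le> \<epsilon> \<and> err m n c 1 \<le> \<epsilon>)"

definition C_sum :: "fb_model \<Rightarrow> real \<Rightarrow> ereal" where
  "C_sum m P = Sup {ereal (r1 + r2) | r1 r2. achievable m P r1 r2}"

(* degrees of freedom: lim C_sum(P)/log2 P; taken as limsup so that the
   bound is meaningful without assuming existence of the limit *)
definition dof :: "fb_model \<Rightarrow> ereal" where
  "dof m = Limsup at_top (\<lambda>P. C_sum m P / ereal (log 2 P))"

end

theory Submission
  imports Defs
begin

text \<open>
  In every feedback model the relay inputs at time t are functions of the messages, of the slots
  before t and of the first-hop coefficients at time t, hence independent of the second-hop
  coefficients and noises of slot t. Even if the relays cooperate and know both messages, the second
  hop is a two-antenna broadcast channel whose transmitter learns the channel too late.

  Let a be one destination, b the other, and let the density p(y | past) be the posterior mixture, over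
  the message of b, of the Gaussian density of one received symbol given the past outputs of both
  destinations and the message of a. Compare the true law with two others. In the first, every output
  of a is replaced by a wide Gaussian and b keeps its conditional law given a, so that a learns nothing
  about its message; the log-likelihood ratio is the sum over t of ln (p(y_a | past) / q(y_a)). In the
  second, both outputs are drawn independently from p, so that b learns nothing about its message.
  A Fano inequality for each comparison bounds 2 ln M_a + ln M_b. In twice the first log-ratio plus
  the second, p occurs only through ln p(y_a | past) - ln p(y_b | past), whose expectation vanishes
  because exchanging the two destinations in slot t preserves the noise law. What remains is
  2 n ln P + O(n); adding the bound with a and b exchanged gives 3 (r_1 + r_2) \<le> 4 log P + O(1).
\<close>

section \<open>The complex Gaussian measure\<close>

abbreviation half_normal :: "real \<Rightarrow> real" where
  "half_normal \<equiv> normal_density 0 (sqrt (1/2))"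

lemma half_normal_eq: "half_normal x = exp (- x\<^sup>2) / sqrt pi"
  by (simp add: normal_density_def)

lemma measurable_Complex [measurable]:
  "(\<lambda>(a, b). Complex a b) \<in> borel_measurable (borel \<Otimes>\<^sub>M borel)"
proof -
  have "(\<lambda>p. complex_of_real (fst p) + \<i> * complex_of_real (snd p)) \<in> borel_measurable (borel \<Otimes>\<^sub>M borel)"
    by measurable
  then show ?thesis
    by (simp add: Complex_eq case_prod_unfold)
qed

lemma prob_space_CN01: "prob_space CN01"
proof -
  let ?D = "density lborel half_normal"
  interpret D: prob_space ?D by (rule prob_space_normal_density) simp
  interpret pair_prob_space ?D ?D ..
  show ?thesis unfolding CN01_def
    by (rule prob_space_distr) measurable
qed

lemma sets_CN01 [measurable_cong, simp]: "sets CN01 = sets borel"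
  by (simp add: CN01_def)

lemma space_CN01 [simp]: "space CN01 = UNIV"
  by (simp add: CN01_def)

text \<open>Reduces CN(0,1) to Lebesgue measure on the plane: the two real Gaussians of variance 1/2
  multiply to the density exp(-|z|^2) / pi.\<close>

lemma nn_integral_CN01:
  assumes [measurable]: "f \<in> borel_measurable borel"
  shows "(\<integral>\<^sup>+z. f z \<partial>CN01) =
    (\<integral>\<^sup>+a. \<integral>\<^sup>+b. ennreal (exp (- a\<^sup>2 - b\<^sup>2) / pi) * f (Complex a b) \<partial>lborel \<partial>lborel)"
proof -
  let ?D = "density lborel half_normal"
  interpret D: prob_space ?D by (rule prob_space_normal_density) simp
  have [measurable]: "(\<lambda>p. f (Complex (fst p) (snd p))) \<in> borel_measurable (borel \<Otimes>\<^sub>M borel)"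
    using measurable_compose[OF measurable_Complex assms] by (simp add: case_prod_unfold)
  have [measurable]: "f \<in> borel_measurable borel" by fact
  have mb: "(\<lambda>b. f (Complex a b)) \<in> borel_measurable borel" for a
    using measurable_compose[OF measurable_Pair1'[of a borel] \<open>(\<lambda>p. f (Complex (fst p) (snd p))) \<in> _\<close>] by simp
  have ma: "(\<lambda>a. \<integral>\<^sup>+b. f (Complex a b) \<partial>?D) \<in> borel_measurable borel"
    using D.borel_measurable_nn_integral[of "\<lambda>a b. f (Complex a b)" borel] by (simp add: case_prod_unfold)
  have "(\<integral>\<^sup>+z. f z \<partial>CN01) = (\<integral>\<^sup>+p. f (Complex (fst p) (snd p)) \<partial>(?D \<Otimes>\<^sub>M ?D))"
    unfolding CN01_def by (subst nn_integral_distr) (auto simp: case_prod_unfold)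
  also have "\<dots> = (\<integral>\<^sup>+a. \<integral>\<^sup>+b. f (Complex a b) \<partial>?D \<partial>?D)"
    by (subst D.nn_integral_fst[symmetric]) auto
  also have "\<dots> = (\<integral>\<^sup>+a. ennreal (half_normal a) * (\<integral>\<^sup>+b. ennreal (half_normal b) * f (Complex a b) \<partial>lborel) \<partial>lborel)"
    using ma mb by (simp add: nn_integral_density)
  also have "\<dots> = (\<integral>\<^sup>+a. \<integral>\<^sup>+b. ennreal (exp (- a\<^sup>2 - b\<^sup>2) / pi) * f (Complex a b) \<partial>lborel \<partial>lborel)"
  proof (intro nn_integral_cong)
    fix a :: real
    have "ennreal (half_normal a) * (\<integral>\<^sup>+b. ennreal (half_normal b) * f (Complex a b) \<partial>lborel) =
       (\<integral>\<^sup>+b. ennreal (half_normal a) * (ennreal (half_normal b) * f (Complex a b)) \<partial>lborel)"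
      using mb by (simp add: nn_integral_cmult)
    also have "\<dots> = (\<integral>\<^sup>+b. ennreal (exp (- a\<^sup>2 - b\<^sup>2) / pi) * f (Complex a b) \<partial>lborel)"
    proof (intro nn_integral_cong)
      fix b :: real
      have "half_normal a * half_normal b = exp (- a\<^sup>2 - b\<^sup>2) / pi"
        unfolding half_normal_eq by (simp add: exp_diff exp_minus field_simps flip: exp_add)
      then show "ennreal (half_normal a) * (ennreal (half_normal b) * f (Complex a b)) =
          ennreal (exp (- a\<^sup>2 - b\<^sup>2) / pi) * f (Complex a b)"
        by (simp add: mult.assoc[symmetric] flip: ennreal_mult)
    qed
    finally show "ennreal (half_normal a) * (\<integral>\<^sup>+b. ennreal (half_normal b) * f (Complex a b) \<partial>lborel) =
      (\<integral>\<^sup>+b. ennreal (exp (- a\<^sup>2 - b\<^sup>2) / pi) * f (Complex a b) \<partial>lborel)" .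
  qed
  finally show ?thesis .
qed

text \<open>A translate of CN(0,1) is absolutely continuous with respect to it. This allows every
  output density below to be taken relative to the noise law itself.\<close>

lemma CN01_shift:
  assumes [measurable]: "f \<in> borel_measurable borel"
  shows "(\<integral>\<^sup>+z. f (z + d) \<partial>CN01) =
    (\<integral>\<^sup>+z. f z * ennreal (exp ((cmod z)\<^sup>2 - (cmod (z - d))\<^sup>2)) \<partial>CN01)"
proof -
  define g where "g = (\<lambda>a b. ennreal (exp (- (a - Re d)\<^sup>2 - (b - Im d)\<^sup>2) / pi) * f (Complex a b))"
  have mc: "(\<lambda>p. f (Complex (fst p) (snd p))) \<in> borel_measurable (borel \<Otimes>\<^sub>M borel)"
    using measurable_compose[OF measurable_Complex assms] by (simp add: case_prod_unfold)
  have g2 [measurable]: "(\<lambda>(a, b). g a b) \<in> borel_measurable (borel \<Otimes>\<^sub>M borel)"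
    using mc unfolding g_def case_prod_unfold by measurable
  have g1 [measurable]: "g a \<in> borel_measurable borel" for a
    using measurable_compose[OF measurable_Pair1'[of a borel] g2] by simp
  have gi [measurable]: "(\<lambda>a. \<integral>\<^sup>+b. g a b \<partial>lborel) \<in> borel_measurable borel"
    using lborel.borel_measurable_nn_integral[of g borel] g2 by simp
  have "(\<integral>\<^sup>+z. f (z + d) \<partial>CN01) = (\<integral>\<^sup>+a. \<integral>\<^sup>+b. g (Re d + a) (Im d + b) \<partial>lborel \<partial>lborel)"
    by (subst nn_integral_CN01) (auto intro!: nn_integral_cong simp: g_def complex_eq_iff
      intro!: arg_cong2[where f="(*)"] arg_cong[where f=f])
  also have "\<dots> = (\<integral>\<^sup>+a. \<integral>\<^sup>+b. g (Re d + a) b \<partial>lborel \<partial>lborel)"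
    using nn_integral_real_affine[OF g1, of 1 _ "Im d"] by simp
  also have "\<dots> = (\<integral>\<^sup>+a. \<integral>\<^sup>+b. g a b \<partial>lborel \<partial>lborel)"
    using nn_integral_real_affine[OF gi, of 1 "Re d"] by simp
  also have "\<dots> = (\<integral>\<^sup>+z. f z * ennreal (exp ((cmod z)\<^sup>2 - (cmod (z - d))\<^sup>2)) \<partial>CN01)"
  proof (subst nn_integral_CN01, measurable, intro nn_integral_cong)
    fix a b
    have "exp (- (a - Re d)\<^sup>2 - (b - Im d)\<^sup>2) = exp (- a\<^sup>2 - b\<^sup>2) *
      exp ((cmod (Complex a b))\<^sup>2 - (cmod (Complex a b - d))\<^sup>2)"
      by (simp add: cmod_power2 flip: exp_add)
    then show "g a b = ennreal (exp (- a\<^sup>2 - b\<^sup>2) / pi) *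
       (f (Complex a b) * ennreal (exp ((cmod (Complex a b))\<^sup>2 - (cmod (Complex a b - d))\<^sup>2)))"
      by (simp add: g_def mult_ac ennreal_mult' flip: ennreal_mult')
  qed
  finally show ?thesis .
qed

lemma CN01_shift_density:
  "(\<integral>\<^sup>+z. ennreal (exp ((cmod z)\<^sup>2 - (cmod (z - d))\<^sup>2)) \<partial>CN01) = 1"
  using CN01_shift[of "\<lambda>_. 1" d] prob_space.emeasure_space_1[OF prob_space_CN01] by simp

text \<open>The integrand is the density of CN(0,P) relative to CN(0,1): the wide Gaussian of the
  first comparison law.\<close>

lemma CN01_scale_density:
  assumes "P > 0"
  shows "(\<integral>\<^sup>+z. ennreal (exp ((cmod z)\<^sup>2 * (1 - 1 / P)) / P) \<partial>CN01) = 1"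
proof -
  \<comment> \<open>Real and imaginary parts of CN(0,P) have variance P/2 each.\<close>
  let ?N = "normal_density 0 (sqrt (P / 2))"
  have N1: "(\<integral>\<^sup>+x. ennreal (?N x) \<partial>lborel) = 1"
    using prob_space.emeasure_space_1[OF prob_space_normal_density[of "sqrt (P/2)" 0]] assms
    by (simp add: emeasure_density)
  have "(\<integral>\<^sup>+z. ennreal (exp ((cmod z)\<^sup>2 * (1 - 1 / P)) / P) \<partial>CN01) =
     (\<integral>\<^sup>+a. \<integral>\<^sup>+b. ennreal (?N a) * ennreal (?N b) \<partial>lborel \<partial>lborel)"
  proof (subst nn_integral_CN01, measurable, intro nn_integral_cong)
    fix a b :: real
    have "?N a * ?N b = exp (- a\<^sup>2 / P + - b\<^sup>2 / P) / (pi * P)"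
      unfolding exp_add using assms by (simp add: normal_density_def real_sqrt_mult field_simps)
    also have "\<dots> = exp (- a\<^sup>2 - b\<^sup>2) / pi * (exp ((cmod (Complex a b))\<^sup>2 * (1 - 1 / P)) / P)"
      by (simp add: cmod_power2 algebra_simps diff_divide_distrib add_divide_distrib flip: exp_add)
    finally show "ennreal (exp (- a\<^sup>2 - b\<^sup>2) / pi) * ennreal (exp ((cmod (Complex a b))\<^sup>2 * (1 - 1 / P)) / P) =
      ennreal (?N a) * ennreal (?N b)"
      using assms by (simp flip: ennreal_mult)
  qed
  also have "\<dots> = 1"
    by (simp add: nn_integral_cmult N1)
  finally show ?thesis .
qed

lemma CN01_second_moment: "(\<integral>\<^sup>+z. ennreal ((cmod z)\<^sup>2) \<partial>CN01) = 1"
proof -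
  have H0: "(\<integral>\<^sup>+x. ennreal (half_normal x) \<partial>lborel) = 1"
    using prob_space.emeasure_space_1[OF prob_space_normal_density[of "sqrt (1/2)" 0]]
    by (simp add: emeasure_density)
  have "has_bochner_integral lborel (\<lambda>x. half_normal x * (x - 0) ^ (2 * 1)) (fact (2 * 1) / ((2 / (sqrt (1/2))\<^sup>2) ^ 1 * fact 1))"
    by (rule normal_moment_even) simp
  then have "has_bochner_integral lborel (\<lambda>x. half_normal x * x\<^sup>2) (1/2)"
    by (simp add: fact_numeral power_divide)
  then have h: "integrable lborel (\<lambda>x. half_normal x * x\<^sup>2)" "(LBINT x. half_normal x * x\<^sup>2) = 1/2"
    by (auto simp only: has_bochner_integral_iff)
  have H2: "(\<integral>\<^sup>+x. ennreal (half_normal x * x\<^sup>2) \<partial>lborel) = ennreal (1/2)"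
    using nn_integral_eq_integral[OF h(1)] h(2) by (metis (no_types, lifting) AE_I2 mult_nonneg_nonneg normal_density_nonneg zero_le_power2)
  have "(\<integral>\<^sup>+z. ennreal ((cmod z)\<^sup>2) \<partial>CN01) =
     (\<integral>\<^sup>+a. \<integral>\<^sup>+b. ennreal (half_normal a * a\<^sup>2) * ennreal (half_normal b) +
        ennreal (half_normal a) * ennreal (half_normal b * b\<^sup>2) \<partial>lborel \<partial>lborel)"
  proof (subst nn_integral_CN01, measurable, intro nn_integral_cong)
    fix a b :: real
    have "half_normal a * half_normal b = exp (- a\<^sup>2 - b\<^sup>2) / pi"
      unfolding half_normal_eq by (simp add: exp_diff exp_minus field_simps flip: exp_add)
    from this[symmetric] have "exp (- a\<^sup>2 - b\<^sup>2) / pi * (cmod (Complex a b))\<^sup>2 =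
       half_normal a * a\<^sup>2 * half_normal b + half_normal a * (half_normal b * b\<^sup>2)"
      unfolding cmod_power2 complex.sel by (simp only: distrib_left mult_ac)
    then show "ennreal (exp (- a\<^sup>2 - b\<^sup>2) / pi) * ennreal ((cmod (Complex a b))\<^sup>2) =
       ennreal (half_normal a * a\<^sup>2) * ennreal (half_normal b) +
        ennreal (half_normal a) * ennreal (half_normal b * b\<^sup>2)"
      by (simp flip: ennreal_mult ennreal_plus)
  qed
  also have "\<dots> = (\<integral>\<^sup>+a. ennreal (half_normal a * a\<^sup>2) + ennreal (half_normal a) * ennreal (1/2) \<partial>lborel)"
    by (simp add: nn_integral_add nn_integral_cmult H0 H2 del: ennreal_half)
  also have "\<dots> = ennreal (1/2) + ennreal (1/2)"
    by (simp add: nn_integral_add nn_integral_multc H0 H2 del: ennreal_half)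
  also have "\<dots> = 1"
    by (metis ennreal_1 ennreal_plus field_sum_of_halves zero_le_divide_1_iff zero_le_numeral)
  finally show ?thesis .
qed

section \<open>Integration over the noise space\<close>

interpretation CN01: prob_space CN01 by (rule prob_space_CN01)

interpretation CN01_prod: product_sigma_finite "\<lambda>_::nat \<times> nat. CN01"
  by standard

lemma prob_space_noiseM: "prob_space (noiseM n)"
  unfolding noiseM_def by (intro prob_space_PiM prob_space_CN01)

abbreviation slots :: "nat \<Rightarrow> (nat \<times> nat) set" where
  "slots n \<equiv> {..<n} \<times> {..<12}"

lemma noiseM_component [measurable (raw)]:
  "c \<in> slots n \<Longrightarrow> (\<lambda>\<eta>. \<eta> c) \<in> borel_measurable (noiseM n)"
  using measurable_component_singleton[of c "slots n" "\<lambda>_. CN01"]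
  by (simp add: noiseM_def cong: measurable_cong_sets)

lemma noiseM_update [measurable (raw)]:
  assumes "c \<in> slots n" "f \<in> measurable M (noiseM n)" "g \<in> borel_measurable M"
  shows "(\<lambda>\<eta>. (f \<eta>)(c := g \<eta>)) \<in> measurable M (noiseM n)"
  using assms unfolding noiseM_def
  by (intro measurable_fun_upd[where J="slots n"]) (auto simp: insert_absorb cong: measurable_cong_sets)

text \<open>Resampling of one coordinate. The outer integral stays on the full space and coordinate
  \<open>c\<close> is overwritten, which avoids products over the remaining index set.\<close>

lemma nn_integral_noiseM_coord:
  assumes c: "c \<in> slots n" and F: "F \<in> borel_measurable (noiseM n)"
  shows "(\<integral>\<^sup>+\<eta>. F \<eta> \<partial>noiseM n) = (\<integral>\<^sup>+\<eta>. \<integral>\<^sup>+z. F (\<eta>(c := z)) \<partial>CN01 \<partial>noiseM n)"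
proof -
  let ?J = "slots n - {c}"
  have I: "insert c ?J = slots n" using c by auto
  have fin: "finite ?J" "c \<notin> ?J" by auto
  have F': "F \<in> borel_measurable (Pi\<^sub>M (insert c ?J) (\<lambda>_. CN01))"
    using F I by (simp add: noiseM_def)
  have G: "(\<lambda>\<eta>. \<integral>\<^sup>+z. F (\<eta>(c := z)) \<partial>CN01) \<in> borel_measurable (noiseM n)"
    by (rule CN01.borel_measurable_nn_integral)
       (use F in \<open>auto simp: case_prod_unfold intro!: measurable_compose[OF _ F] noiseM_update c\<close>)
  then have G': "(\<lambda>\<eta>. \<integral>\<^sup>+z. F (\<eta>(c := z)) \<partial>CN01) \<in> borel_measurable (Pi\<^sub>M (insert c ?J) (\<lambda>_. CN01))"
    using I by (simp add: noiseM_def)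
  \<comment> \<open>Splitting off \<open>c\<close> on both sides leaves on the right an integrand
    that ignores \<open>c\<close>, and \<open>CN01\<close> has mass 1.\<close>
  show ?thesis
    using CN01_prod.product_nn_integral_insert[OF fin F'] CN01_prod.product_nn_integral_insert[OF fin G'] I
    by (simp add: noiseM_def CN01.emeasure_space_1[simplified])
qed

text \<open>The shift \<open>h\<close> may depend on all other coordinates: once these are fixed it
  is a constant, and \<open>CN01_shift\<close> applies.\<close>

lemma nn_integral_noiseM_shift:
  assumes c: "c \<in> slots n" and F: "F \<in> borel_measurable (noiseM n)"
    and h: "h \<in> borel_measurable (noiseM n)" and inv: "\<And>\<eta> z. h (\<eta>(c := z)) = h \<eta>"
  shows "(\<integral>\<^sup>+\<eta>. F (\<eta>(c := \<eta> c + h \<eta>)) \<partial>noiseM n) =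
    (\<integral>\<^sup>+\<eta>. F \<eta> * ennreal (exp ((cmod (\<eta> c))\<^sup>2 - (cmod (\<eta> c - h \<eta>))\<^sup>2)) \<partial>noiseM n)"
proof -
  note [measurable] = F h
  have "(\<lambda>\<eta>. F (\<eta>(c := \<eta> c + h \<eta>))) \<in> borel_measurable (noiseM n)"
    by (rule measurable_compose[OF _ F]) (use c in measurable)
  then have "(\<integral>\<^sup>+\<eta>. F (\<eta>(c := \<eta> c + h \<eta>)) \<partial>noiseM n) =
      (\<integral>\<^sup>+\<eta>. \<integral>\<^sup>+z. F (\<eta>(c := z + h \<eta>)) \<partial>CN01 \<partial>noiseM n)"
    by (subst nn_integral_noiseM_coord[OF c]) (simp_all add: inv)
  also have "\<dots> = (\<integral>\<^sup>+\<eta>. \<integral>\<^sup>+z. F (\<eta>(c := z)) * ennreal (exp ((cmod z)\<^sup>2 - (cmod (z - h \<eta>))\<^sup>2)) \<partial>CN01 \<partial>noiseM n)"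
  proof (rule nn_integral_cong)
    fix \<eta> assume "\<eta> \<in> space (noiseM n)"
    then have "(\<lambda>z. F (\<eta>(c := z))) \<in> borel_measurable borel"
      by (intro measurable_compose[OF _ F] noiseM_update c) auto
    then show "(\<integral>\<^sup>+z. F (\<eta>(c := z + h \<eta>)) \<partial>CN01) =
       (\<integral>\<^sup>+z. F (\<eta>(c := z)) * ennreal (exp ((cmod z)\<^sup>2 - (cmod (z - h \<eta>))\<^sup>2)) \<partial>CN01)"
      by (rule CN01_shift)
  qed
  also have "\<dots> = (\<integral>\<^sup>+\<eta>. F \<eta> * ennreal (exp ((cmod (\<eta> c))\<^sup>2 - (cmod (\<eta> c - h \<eta>))\<^sup>2)) \<partial>noiseM n)"
    by (subst (2) nn_integral_noiseM_coord[OF c]) (use c in \<open>simp_all add: inv\<close>)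
  finally show ?thesis .
qed

text \<open>\<open>K\<close> acts as a conditional probability density of coordinate
  \<open>c\<close> given the others, so it disappears when the rest of the integrand ignores
  \<open>c\<close>.\<close>

lemma nn_integral_noiseM_kernel:
  assumes c: "c \<in> slots n" and G: "G \<in> borel_measurable (noiseM n)" and K: "K \<in> borel_measurable (noiseM n)"
    and inv: "\<And>\<eta> z. G (\<eta>(c := z)) = G \<eta>"
    and le: "\<And>\<eta>. (\<integral>\<^sup>+z. K (\<eta>(c := z)) \<partial>CN01) = 1"
  shows "(\<integral>\<^sup>+\<eta>. G \<eta> * K \<eta> \<partial>noiseM n) = (\<integral>\<^sup>+\<eta>. G \<eta> \<partial>noiseM n)"
proof -
  note [measurable] = G K
  have "(\<integral>\<^sup>+\<eta>. G \<eta> * K \<eta> \<partial>noiseM n) = (\<integral>\<^sup>+\<eta>. \<integral>\<^sup>+z. G \<eta> * K (\<eta>(c := z)) \<partial>CN01 \<partial>noiseM n)"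
    by (subst nn_integral_noiseM_coord[OF c]) (simp_all add: inv)
  also have "\<dots> = (\<integral>\<^sup>+\<eta>. G \<eta> \<partial>noiseM n)"
  proof (rule nn_integral_cong)
    fix \<eta> assume "\<eta> \<in> space (noiseM n)"
    then have "(\<lambda>z. K (\<eta>(c := z))) \<in> borel_measurable CN01"
      by (intro measurable_compose[OF _ K] noiseM_update c) auto
    then show "(\<integral>\<^sup>+z. G \<eta> * K (\<eta>(c := z)) \<partial>CN01) = G \<eta>"
      by (subst nn_integral_cmult) (auto simp: le)
  qed
  finally show ?thesis .
qed

text \<open>Exchanges, in slot \<open>t\<close> only, the coefficient rows of the two destinations
  (4, 5 against 6, 7) and their noises or outputs (10 against 11). The first hop stays
  fixed.\<close>

definition swap_receivers :: "nat \<Rightarrow> (nat \<times> nat \<Rightarrow> complex) \<Rightarrow> nat \<times> nat \<Rightarrow> complex" where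
  "swap_receivers t \<eta> = \<eta>((t,4) := \<eta> (t,6), (t,5) := \<eta> (t,7), (t,6) := \<eta> (t,4), (t,7) := \<eta> (t,5),
     (t,10) := \<eta> (t,11), (t,11) := \<eta> (t,10))"

lemma measurable_swap_receivers:
  "t < n \<Longrightarrow> swap_receivers t \<in> measurable (noiseM n) (noiseM n)"
  unfolding swap_receivers_def by measurable

text \<open>The exchange is an involutive permutation of i.i.d. coordinates.\<close>

lemma distr_swap_receivers:
  assumes "t < n"
  shows "distr (noiseM n) (noiseM n) (swap_receivers t) = noiseM n"
proof -
  define p where "p = (id :: nat \<times> nat \<Rightarrow> _)((t,4) := (t,6), (t,5) := (t,7), (t,6) := (t,4), (t,7) := (t,5),
     (t,10) := (t,11), (t,11) := (t,10))"
  have pp: "p (p x) = x" for x by (auto simp: p_def)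
  have inj: "inj_on p (slots n)" by (metis inj_onI pp)
  have pi: "p \<in> slots n \<rightarrow> slots n" using assms by (auto simp: p_def)
  have "distr (noiseM n) (noiseM n) (\<lambda>\<eta>. \<lambda>c\<in>slots n. \<eta> (p c)) = noiseM n"
    using distr_PiM_reindex[of "slots n" "\<lambda>_. CN01" p "slots n"] inj pi prob_space_CN01 by (simp add: noiseM_def)
  moreover have "(\<lambda>c\<in>slots n. \<eta> (p c)) = swap_receivers t \<eta>" if "\<eta> \<in> space (noiseM n)" for \<eta>
    using that assms by (auto simp: fun_eq_iff swap_receivers_def p_def noiseM_def space_PiM PiE_def extensional_def restrict_def)
  then have "distr (noiseM n) (noiseM n) (\<lambda>\<eta>. \<lambda>c\<in>slots n. \<eta> (p c)) = distr (noiseM n) (noiseM n) (swap_receivers t)"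
    by (intro distr_cong) auto
  ultimately show ?thesis by simp
qed

lemma integral_swap_receivers:
  fixes F :: "_ \<Rightarrow> real"
  assumes "t < n" "F \<in> borel_measurable (noiseM n)"
  shows "(\<integral>\<eta>. F (swap_receivers t \<eta>) \<partial>noiseM n) = (\<integral>\<eta>. F \<eta> \<partial>noiseM n)"
  using integral_distr[OF measurable_swap_receivers[OF assms(1)] assms(2)] distr_swap_receivers[OF assms(1)] by simp

section \<open>Broadcast over the second hop\<close>

text \<open>
  Points \<^term>\<open>\<eta>\<close> are samples of the noise space or, when densities are concerned, output samples, in
  which coordinate \<open>(t, 10 + i)\<close> holds the received symbol of destination \<open>i\<close> instead of its noise.
  The relay signals \<open>xt u v t j\<close> are functions of output samples; \<open>u\<close> and \<open>v\<close> are the messages of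
  destinations \<open>a\<close> and \<open>b\<close>. All densities are relative to \<open>noiseM n\<close>.
\<close>

locale relay_broadcast =
  fixes n a b Ma Mb :: nat and P :: real
    and xt :: "nat \<Rightarrow> nat \<Rightarrow> nat \<Rightarrow> nat \<Rightarrow> (nat \<times> nat \<Rightarrow> complex) \<Rightarrow> complex"
    and \<delta>a \<delta>b :: "(nat \<times> nat \<Rightarrow> complex) \<Rightarrow> nat"
  assumes ab: "a = 0 \<and> b = 1 \<or> a = 1 \<and> b = 0"
    and Ma_pos: "Ma > 0" and Mb_pos: "Mb > 0" and P_ge_1: "P \<ge> 1"
    and xt_upd: "\<And>u v t j \<eta> s k z. t < s \<or> s = t \<and> 4 \<le> k \<Longrightarrow> xt u v t j (\<eta>((s, k) := z)) = xt u v t j \<eta>"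
    and xt_meas: "\<And>u v t j. u < Ma \<Longrightarrow> v < Mb \<Longrightarrow> t < n \<Longrightarrow> j < 2 \<Longrightarrow>
        xt u v t j \<in> borel_measurable (noiseM n)"
    and \<delta>a_meas: "\<And>u. u < Ma \<Longrightarrow> {\<eta> \<in> space (noiseM n). \<delta>a \<eta> = u} \<in> sets (noiseM n)"
    and \<delta>b_meas: "\<And>v. v < Mb \<Longrightarrow> {\<eta> \<in> space (noiseM n). \<delta>b \<eta> = v} \<in> sets (noiseM n)"
    and \<delta>a_upd: "\<And>\<eta> s z. \<delta>a (\<eta>((s, 10 + b) := z)) = \<delta>a \<eta>"
begin

text \<open>The noiseless part of the symbol received by destination \<open>i\<close>, expressed
  through earlier outputs so that feedback is included.\<close>

definition mean :: "nat \<Rightarrow> nat \<Rightarrow> nat \<Rightarrow> nat \<Rightarrow> (nat \<times> nat \<Rightarrow> complex) \<Rightarrow> complex" where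
  "mean u v t i \<eta> = Gc \<eta> t i 0 * xt u v t 0 \<eta> + Gc \<eta> t i 1 * xt u v t 1 \<eta>"

text \<open>Density of the received symbol, Gaussian around \<open>mean\<close>, relative to
  CN(0,1); see \<open>CN01_shift\<close>.\<close>

definition lik :: "nat \<Rightarrow> nat \<Rightarrow> nat \<Rightarrow> nat \<Rightarrow> (nat \<times> nat \<Rightarrow> complex) \<Rightarrow> real" where
  "lik u v t i \<eta> = exp ((cmod (\<eta> (t, 10 + i)))\<^sup>2 - (cmod (\<eta> (t, 10 + i) - mean u v t i \<eta>))\<^sup>2)"

text \<open>Joint density of the outputs of both destinations before slot \<open>t\<close>, given
  both messages.\<close>

definition dens :: "nat \<Rightarrow> nat \<Rightarrow> nat \<Rightarrow> (nat \<times> nat \<Rightarrow> complex) \<Rightarrow> real" where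
  "dens u v t \<eta> = (\<Prod>s<t. lik u v s a \<eta> * lik u v s b \<eta>)"

text \<open>
  The posterior predictive density, plus 1: this keeps its logarithm between 0 and the squared
  modulus of the received symbol up to a constant, hence integrable, and costs only ln 2 per symbol.
\<close>

definition pred :: "nat \<Rightarrow> nat \<Rightarrow> nat \<Rightarrow> (nat \<times> nat \<Rightarrow> complex) \<Rightarrow> real" where
  "pred u t i \<eta> = 1 + (\<Sum>v<Mb. dens u v t \<eta> * lik u v t i \<eta>) / (\<Sum>v<Mb. dens u v t \<eta>)"

text \<open>The density of \<open>CN01_scale_density\<close>: an output of \<open>a\<close> drawn
  from CN(0,P) regardless of messages and past.\<close>

definition wide :: "nat \<Rightarrow> (nat \<times> nat \<Rightarrow> complex) \<Rightarrow> real" where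
  "wide t \<eta> = exp ((cmod (\<eta> (t, 10 + a)))\<^sup>2 * (1 - 1 / P)) / P"

text \<open>Turns the noises of slot \<open>t\<close> into outputs, provided that earlier slots
  already hold outputs; this is why \<open>outp\<close> treats the slots in increasing
  order.\<close>

definition shift :: "nat \<Rightarrow> nat \<Rightarrow> nat \<Rightarrow> (nat \<times> nat \<Rightarrow> complex) \<Rightarrow> nat \<times> nat \<Rightarrow> complex" where
  "shift u v t \<eta> = \<eta>((t, 10 + a) := \<eta> (t, 10 + a) + mean u v t a \<eta>, (t, 10 + b) := \<eta> (t, 10 + b) + mean u v t b \<eta>)"

primrec outp :: "nat \<Rightarrow> nat \<Rightarrow> nat \<Rightarrow> (nat \<times> nat \<Rightarrow> complex) \<Rightarrow> nat \<times> nat \<Rightarrow> complex" where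
  "outp u v 0 \<eta> = \<eta>"
| "outp u v (Suc t) \<eta> = shift u v t (outp u v t \<eta>)"

section \<open>Which coordinates each quantity depends on\<close>

lemma ab_simps: "a < 2" "b < 2" "a \<noteq> b" "b \<noteq> a" "a \<le> 1" "b \<le> 1"
  using ab by auto

lemma slot_mem: "t < n \<Longrightarrow> (t, 10 + a) \<in> slots n" "t < n \<Longrightarrow> (t, 10 + b) \<in> slots n"
  using ab by auto

text \<open>In its own slot \<open>mean\<close> reads only channel coefficients: coordinates 8 to
  11, the relay noises and the outputs, come too late for the relays.\<close>

lemma mean_upd: "i < 2 \<Longrightarrow> t < s \<or> s = t \<and> 8 \<le> k \<Longrightarrow> mean u v t i (\<eta>((s, k) := z)) = mean u v t i \<eta>"
  by (auto simp: mean_def Gc_def xt_upd)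

lemma lik_upd: "i < 2 \<Longrightarrow> t < s \<or> s = t \<and> 8 \<le> k \<and> k \<noteq> 10 + i \<Longrightarrow> lik u v t i (\<eta>((s, k) := z)) = lik u v t i \<eta>"
  using mean_upd[of i t s k u v \<eta> z] by (auto simp: lik_def)

lemma lik_upd_self: "i < 2 \<Longrightarrow>
  lik u v t i (\<eta>((t, 10 + i) := z)) = exp ((cmod z)\<^sup>2 - (cmod (z - mean u v t i \<eta>))\<^sup>2)"
  by (simp add: lik_def mean_upd)

lemma dens_upd: "t \<le> s \<Longrightarrow> dens u v t (\<eta>((s, k) := z)) = dens u v t \<eta>"
  by (simp add: dens_def lik_upd ab_simps)

lemma pred_upd: "i < 2 \<Longrightarrow> t < s \<or> s = t \<and> 8 \<le> k \<and> k \<noteq> 10 + i \<Longrightarrow> pred u t i (\<eta>((s, k) := z)) = pred u t i \<eta>"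
  using lik_upd[of i t s k] dens_upd[of t s] by (auto simp: pred_def)

lemma wide_upd: "(s, k) \<noteq> (t, 10 + a) \<Longrightarrow> wide t (\<eta>((s, k) := z)) = wide t \<eta>"
  by (auto simp: wide_def)

lemma shift_upd: "t < s \<Longrightarrow> shift u v t (\<eta>((s, k) := z)) = (shift u v t \<eta>)((s, k) := z)"
  by (auto simp: shift_def mean_upd ab_simps fun_eq_iff)

lemma outp_upd: "t \<le> s \<Longrightarrow> outp u v t (\<eta>((s, k) := z)) = (outp u v t \<eta>)((s, k) := z)"
  by (induction t) (auto simp: shift_upd)

section \<open>Positivity and measurability\<close>

lemma lik_pos: "lik u v t i \<eta> > 0" by (simp add: lik_def)
lemma dens_pos: "dens u v t \<eta> > 0" by (auto simp: dens_def lik_pos intro!: prod_pos mult_pos_pos)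
lemma dens_sum_pos: "(\<Sum>v<Mb. dens u v t \<eta>) > 0"
  using Mb_pos by (intro sum_pos) (auto simp: dens_pos)
lemma pred_ge_1: "pred u t i \<eta> \<ge> 1"
  unfolding pred_def le_add_same_cancel1
  by (intro divide_nonneg_nonneg sum_nonneg mult_nonneg_nonneg less_imp_le[OF lik_pos] less_imp_le[OF dens_pos])
lemma pred_pos: "pred u t i \<eta> > 0" using pred_ge_1[of u t i \<eta>] by linarith
lemma wide_pos: "wide t \<eta> > 0" using P_ge_1 by (simp add: wide_def)

lemma mean_meas: "u < Ma \<Longrightarrow> v < Mb \<Longrightarrow> t < n \<Longrightarrow> i < 2 \<Longrightarrow> mean u v t i \<in> borel_measurable (noiseM n)"
  using xt_meas[of u v t 0] xt_meas[of u v t 1] unfolding mean_def Gc_def by measurable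

lemma lik_meas: "u < Ma \<Longrightarrow> v < Mb \<Longrightarrow> t < n \<Longrightarrow> i < 2 \<Longrightarrow> lik u v t i \<in> borel_measurable (noiseM n)"
  using mean_meas[of u v t i] unfolding lik_def by measurable

lemma dens_meas: "u < Ma \<Longrightarrow> v < Mb \<Longrightarrow> t \<le> n \<Longrightarrow> dens u v t \<in> borel_measurable (noiseM n)"
  unfolding dens_def by (intro borel_measurable_prod borel_measurable_times lik_meas) (auto simp: ab_simps)

lemma pred_meas: "u < Ma \<Longrightarrow> t < n \<Longrightarrow> i < 2 \<Longrightarrow> pred u t i \<in> borel_measurable (noiseM n)"
  unfolding pred_def
  by (intro borel_measurable_divide borel_measurable_sum borel_measurable_times borel_measurable_add lik_meas dens_meas) auto

lemma wide_meas: "t < n \<Longrightarrow> wide t \<in> borel_measurable (noiseM n)"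
  using noiseM_component[OF slot_mem(1)] unfolding wide_def by measurable

lemma shift_meas: "u < Ma \<Longrightarrow> v < Mb \<Longrightarrow> t < n \<Longrightarrow> shift u v t \<in> measurable (noiseM n) (noiseM n)"
  unfolding shift_def by (intro noiseM_update borel_measurable_add mean_meas noiseM_component) (auto simp: ab_simps intro: le_less_trans[OF ab_simps(5)] le_less_trans[OF ab_simps(6)])

lemma outp_meas: "u < Ma \<Longrightarrow> v < Mb \<Longrightarrow> t \<le> n \<Longrightarrow> outp u v t \<in> measurable (noiseM n) (noiseM n)"
proof (induction t)
  case (Suc t)
  then show ?case
    using measurable_compose[OF Suc.IH shift_meas[of u v t]] by (simp del: fun_upd_apply)
next
  case 0 then show ?case by (simp add: measurable_ident_sets)
qed

section \<open>Change of measure and mass of the comparison laws\<close>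

text \<open>Under the noise law the output sample has density \<open>dens\<close>: each slot
  contributes two likelihood factors, one for each shifted coordinate.\<close>

lemma nn_integral_outp:
  assumes uv: "u < Ma" "v < Mb" and "t \<le> n" and "F \<in> borel_measurable (noiseM n)"
  shows "(\<integral>\<^sup>+\<eta>. F (outp u v t \<eta>) \<partial>noiseM n) = (\<integral>\<^sup>+\<eta>. F \<eta> * ennreal (dens u v t \<eta>) \<partial>noiseM n)"
  using assms(3,4)
proof (induction t arbitrary: F)
  case 0 then show ?case by (simp add: dens_def)
next
  case (Suc t)
  then have t: "t < n" and F: "F \<in> borel_measurable (noiseM n)" by auto
  let ?c = "(t, 10 + a)" and ?d = "(t, 10 + b)"
  have cd: "?c \<in> slots n" "?d \<in> slots n" using t ab by auto
  define G where "G \<eta> = F \<eta> * ennreal (dens u v t \<eta>)" for \<eta>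
  have G: "G \<in> borel_measurable (noiseM n)"
    using dens_meas[OF uv less_imp_le[OF t]] F unfolding G_def by measurable
  have F': "(\<lambda>\<eta>. F (shift u v t \<eta>)) \<in> borel_measurable (noiseM n)"
    using measurable_compose[OF shift_meas[OF uv t] F] by simp
  have ma: "mean u v t a \<in> borel_measurable (noiseM n)" and mb: "mean u v t b \<in> borel_measurable (noiseM n)"
    using mean_meas[OF uv t] ab_simps by auto
  have la: "lik u v t a \<in> borel_measurable (noiseM n)"
    using lik_meas[OF uv t] ab_simps by auto
  have "(\<integral>\<^sup>+\<eta>. F (outp u v (Suc t) \<eta>) \<partial>noiseM n) = (\<integral>\<^sup>+\<eta>. F (shift u v t \<eta>) * ennreal (dens u v t \<eta>) \<partial>noiseM n)"
    using Suc.IH[OF _ F'] t by simp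
  also have "\<dots> = (\<integral>\<^sup>+\<eta>. G (shift u v t \<eta>) \<partial>noiseM n)"
    by (simp add: G_def shift_def dens_upd)
  \<comment> \<open>The two outputs are shifted one after the other, which is the same as shifting
    both at once because \<open>mean\<close> reads no output of its own slot.\<close>
  also have "\<dots> = (\<integral>\<^sup>+\<eta>. (\<lambda>\<eta>. G (\<eta>(?d := \<eta> ?d + mean u v t b \<eta>))) (\<eta>(?c := \<eta> ?c + mean u v t a \<eta>)) \<partial>noiseM n)"
    by (simp add: shift_def mean_upd ab_simps)
  also have "\<dots> = (\<integral>\<^sup>+\<eta>. G (\<eta>(?d := \<eta> ?d + mean u v t b \<eta>)) * ennreal (lik u v t a \<eta>) \<partial>noiseM n)"
    unfolding lik_def
    by (rule nn_integral_noiseM_shift[OF cd(1) _ ma])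
       (auto simp: mean_upd ab_simps intro!: measurable_compose[OF _ G] noiseM_update cd(2) mb borel_measurable_add noiseM_component)
  also have "\<dots> = (\<integral>\<^sup>+\<eta>. (\<lambda>\<eta>. G \<eta> * ennreal (lik u v t a \<eta>)) (\<eta>(?d := \<eta> ?d + mean u v t b \<eta>)) \<partial>noiseM n)"
    by (simp add: lik_upd ab_simps)
  also have "\<dots> = (\<integral>\<^sup>+\<eta>. (G \<eta> * ennreal (lik u v t a \<eta>)) * ennreal (lik u v t b \<eta>) \<partial>noiseM n)"
    unfolding lik_def[of u v t b]
    by (rule nn_integral_noiseM_shift[OF cd(2) _ mb])
       (use G la in \<open>auto simp: mean_upd ab_simps\<close>)
  also have "\<dots> = (\<integral>\<^sup>+\<eta>. F \<eta> * ennreal (dens u v (Suc t) \<eta>) \<partial>noiseM n)"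
    using lik_pos dens_pos by (auto intro!: nn_integral_cong simp: G_def dens_def ennreal_mult less_imp_le prod_nonneg mult.assoc)
  finally show ?case .
qed

lemma nn_integral_lik:
  "i < 2 \<Longrightarrow> (\<integral>\<^sup>+z. ennreal (lik u v t i (\<eta>((t, 10 + i) := z))) \<partial>CN01) = 1"
  by (simp add: lik_upd_self CN01_shift_density)

lemma nn_integral_wide: "(\<integral>\<^sup>+z. ennreal (wide t (\<eta>((t, 10 + a) := z))) \<partial>CN01) = 1"
  using CN01_scale_density[of P] P_ge_1 by (simp add: wide_def)

text \<open>The added 1 gives \<open>pred\<close> the mass 2: half of it is the even mixture of
  CN(0,1) with the posterior mixture of output densities. This 2 is the source of the ln 2 per
  symbol.\<close>

lemma nn_integral_pred:
  assumes "i < 2"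
  shows "(\<integral>\<^sup>+z. ennreal (pred u t i (\<eta>((t, 10 + i) := z)) / 2) \<partial>CN01) = 1"
proof -
  \<comment> \<open>Posterior weights of the messages of \<open>b\<close>, given the past outputs
    and the message \<open>u\<close> of \<open>a\<close>.\<close>
  define p where "p v = dens u v t \<eta> / (\<Sum>v<Mb. dens u v t \<eta>)" for v
  have p: "p v \<ge> 0" for v using dens_pos dens_sum_pos by (simp add: p_def less_imp_le)
  have p1: "(\<Sum>v<Mb. p v) = 1"
    using dens_sum_pos[of u t \<eta>] by (simp add: p_def flip: sum_divide_distrib)
  let ?e = "\<lambda>v z. exp ((cmod z)\<^sup>2 - (cmod (z - mean u v t i \<eta>))\<^sup>2)"
  have "pred u t i (\<eta>((t, 10 + i) := z)) / 2 = 1/2 + (\<Sum>v<Mb. p v / 2 * ?e v z)" for z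
    using assms by (simp add: pred_def dens_upd lik_upd_self[OF assms] p_def sum_divide_distrib add_divide_distrib)
  then have "ennreal (pred u t i (\<eta>((t, 10 + i) := z)) / 2) = ennreal (1/2) + (\<Sum>v<Mb. ennreal (p v / 2) * ennreal (?e v z))" for z
    using p by (simp only: ennreal_plus sum_nonneg ennreal_mult' mult_nonneg_nonneg divide_nonneg_nonneg
      exp_ge_zero zero_le_numeral zero_le_one sum_ennreal[symmetric])
  then have "(\<integral>\<^sup>+z. ennreal (pred u t i (\<eta>((t, 10 + i) := z)) / 2) \<partial>CN01) = ennreal (1/2) + (\<Sum>v<Mb. ennreal (p v / 2))"
    by (simp add: nn_integral_add nn_integral_sum nn_integral_cmult CN01_shift_density CN01.emeasure_space_1[simplified] del: ennreal_half)
  also have "\<dots> = 1"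
    using p p1 by (simp add: sum_ennreal flip: sum_divide_distrib ennreal_plus del: ennreal_half)
  finally show ?thesis .
qed

lemma nn_integral_prod_wide: "t \<le> n \<Longrightarrow> (\<integral>\<^sup>+\<eta>. ennreal (\<Prod>s<t. wide s \<eta>) \<partial>noiseM n) = 1"
proof (induction t)
  case 0 show ?case using prob_space.emeasure_space_1[OF prob_space_noiseM] by simp
next
  case (Suc t)
  have "(\<integral>\<^sup>+\<eta>. ennreal (\<Prod>s<Suc t. wide s \<eta>) \<partial>noiseM n) =
      (\<integral>\<^sup>+\<eta>. ennreal (\<Prod>s<t. wide s \<eta>) * ennreal (wide t \<eta>) \<partial>noiseM n)"
    using wide_pos by (auto intro!: nn_integral_cong simp: ennreal_mult less_imp_le prod_nonneg)
  also have "\<dots> = (\<integral>\<^sup>+\<eta>. ennreal (\<Prod>s<t. wide s \<eta>) \<partial>noiseM n)"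
    by (rule nn_integral_noiseM_kernel[of "(t, 10 + a)"])
       (use Suc.prems ab in \<open>auto simp: wide_upd nn_integral_wide[simplified] intro!: borel_measurable_prod wide_meas measurable_compose[OF _ measurable_ennreal]\<close>)
  finally show ?case using Suc by simp
qed

text \<open>Normalises the second comparison law. Within a slot, \<open>pred\<close> for one
  destination ignores the output of the other, so the two outputs are integrated out in turn, last
  slot first.\<close>

lemma nn_integral_prod_pred:
  "u < Ma \<Longrightarrow> t \<le> n \<Longrightarrow> (\<integral>\<^sup>+\<eta>. ennreal (\<Prod>s<t. pred u s a \<eta> / 2 * (pred u s b \<eta> / 2)) \<partial>noiseM n) = 1"
proof (induction t)
  case 0 show ?case using prob_space.emeasure_space_1[OF prob_space_noiseM] by simp
next
  case (Suc t)
  then have t: "t < n" by simp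
  let ?p = "\<lambda>\<eta>. \<Prod>s<t. pred u s a \<eta> / 2 * (pred u s b \<eta> / 2)"
  have pm [measurable]: "?p \<in> borel_measurable (noiseM n)"
    using Suc.prems ab_simps by (intro borel_measurable_prod borel_measurable_times borel_measurable_divide pred_meas) auto
  have am: "pred u t a \<in> borel_measurable (noiseM n)" "pred u t b \<in> borel_measurable (noiseM n)"
    using Suc.prems ab_simps pred_meas by auto
  note [measurable] = am
  have "(\<integral>\<^sup>+\<eta>. ennreal (\<Prod>s<Suc t. pred u s a \<eta> / 2 * (pred u s b \<eta> / 2)) \<partial>noiseM n) =
      (\<integral>\<^sup>+\<eta>. (ennreal (?p \<eta>) * ennreal (pred u t a \<eta> / 2)) * ennreal (pred u t b \<eta> / 2) \<partial>noiseM n)"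
    by (intro nn_integral_cong, simp only: prod.lessThan_Suc mult.assoc, subst ennreal_mult)
       (auto intro!: prod_nonneg mult_nonneg_nonneg less_imp_le[OF pred_pos] simp: less_imp_le[OF pred_pos] simp flip: ennreal_mult)
  also have "\<dots> = (\<integral>\<^sup>+\<eta>. ennreal (?p \<eta>) * ennreal (pred u t a \<eta> / 2) \<partial>noiseM n)"
    by (rule nn_integral_noiseM_kernel[OF slot_mem(2)[OF t]], measurable)
       (use ab_simps in \<open>simp_all add: pred_upd nn_integral_pred\<close>)
  also have "\<dots> = (\<integral>\<^sup>+\<eta>. ennreal (?p \<eta>) \<partial>noiseM n)"
    by (rule nn_integral_noiseM_kernel[OF slot_mem(1)[OF t]], measurable)
       (use ab_simps in \<open>simp_all add: pred_upd nn_integral_pred\<close>)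
  finally show ?case using Suc by simp
qed

text \<open>
  \<open>F\<close> does not see the outputs of \<open>b\<close>, so these can be integrated out from the last slot backwards;
  each integration cancels one predictive density.
\<close>

lemma nn_integral_weak_receiver:
  assumes u: "u < Ma" and "t \<le> n" and "F \<in> borel_measurable (noiseM n)"
    and "\<And>s \<eta> z. F (\<eta>((s, 10 + b) := z)) = F \<eta>"
  shows "(\<integral>\<^sup>+\<eta>. F \<eta> * ennreal ((\<Sum>v<Mb. dens u v t \<eta>) * (\<Prod>s<t. wide s \<eta> / pred u s a \<eta>)) \<partial>noiseM n)
     \<le> of_nat Mb * (\<integral>\<^sup>+\<eta>. F \<eta> * ennreal (\<Prod>s<t. wide s \<eta>) \<partial>noiseM n)"
  using assms(2-)
proof (induction t arbitrary: F)
  case 0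
  then show ?case
    by (simp add: dens_def nn_integral_multc mult.commute ennreal_of_nat_eq_real_of_nat)
next
  case (Suc t)
  then have t: "t < n" by simp
  let ?w = "\<lambda>\<eta>. \<Prod>s<t. wide s \<eta> / pred u s a \<eta>"
  define G where "G v \<eta> = F \<eta> * ennreal (dens u v t \<eta> * lik u v t a \<eta> * ?w \<eta> * (wide t \<eta> / pred u t a \<eta>))" for v \<eta>
  have [measurable]: "F \<in> borel_measurable (noiseM n)" "?w \<in> borel_measurable (noiseM n)"
     "wide t \<in> borel_measurable (noiseM n)" "pred u t a \<in> borel_measurable (noiseM n)"
    using Suc.prems u t ab_simps by (auto intro!: borel_measurable_prod borel_measurable_divide wide_meas pred_meas)
  have G: "G v \<in> borel_measurable (noiseM n)" if "v < Mb" for v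
    using dens_meas[OF u that less_imp_le[OF t]] lik_meas[OF u that t ab_simps(1)] unfolding G_def by measurable
  have w_pos: "?w \<eta> > 0" for \<eta> using wide_pos pred_pos by (auto intro!: prod_pos divide_pos_pos)
  have wt_pos: "wide t \<eta> / pred u t a \<eta> > 0" for \<eta> using wide_pos pred_pos by auto
  note pos = less_imp_le[OF lik_pos] less_imp_le[OF dens_pos] less_imp_le[OF w_pos] less_imp_le[OF wt_pos]
    less_imp_le[OF wide_pos] less_imp_le[OF pred_pos]
  have "(\<integral>\<^sup>+\<eta>. F \<eta> * ennreal ((\<Sum>v<Mb. dens u v (Suc t) \<eta>) * (\<Prod>s<Suc t. wide s \<eta> / pred u s a \<eta>)) \<partial>noiseM n) =
     (\<integral>\<^sup>+\<eta>. (\<Sum>v<Mb. G v \<eta> * ennreal (lik u v t b \<eta>)) \<partial>noiseM n)"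
  proof (rule nn_integral_cong)
    fix \<eta>
    have "(\<Sum>v<Mb. dens u v (Suc t) \<eta>) * (\<Prod>s<Suc t. wide s \<eta> / pred u s a \<eta>) =
      (\<Sum>v<Mb. dens u v t \<eta> * lik u v t a \<eta> * ?w \<eta> * (wide t \<eta> / pred u t a \<eta>) * lik u v t b \<eta>)"
      unfolding sum_distrib_right dens_def prod.lessThan_Suc by (intro sum.cong refl) (simp only: mult_ac)
    then have "ennreal ((\<Sum>v<Mb. dens u v (Suc t) \<eta>) * (\<Prod>s<Suc t. wide s \<eta> / pred u s a \<eta>)) =
      (\<Sum>v<Mb. ennreal (dens u v t \<eta> * lik u v t a \<eta> * ?w \<eta> * (wide t \<eta> / pred u t a \<eta>)) * ennreal (lik u v t b \<eta>))"
      by (simp only: sum_ennreal[symmetric] mult_nonneg_nonneg pos ennreal_mult)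
    then show "F \<eta> * ennreal ((\<Sum>v<Mb. dens u v (Suc t) \<eta>) * (\<Prod>s<Suc t. wide s \<eta> / pred u s a \<eta>)) =
       (\<Sum>v<Mb. G v \<eta> * ennreal (lik u v t b \<eta>))"
      by (simp add: G_def sum_distrib_left mult.assoc)
  qed
  also have "\<dots> = (\<Sum>v<Mb. \<integral>\<^sup>+\<eta>. G v \<eta> * ennreal (lik u v t b \<eta>) \<partial>noiseM n)"
    using G lik_meas[OF u _ t, of _ b] ab_simps by (intro nn_integral_sum borel_measurable_times_ennreal measurable_compose[OF _ measurable_ennreal]) auto
  also have "\<dots> = (\<Sum>v<Mb. \<integral>\<^sup>+\<eta>. G v \<eta> \<partial>noiseM n)"
  proof (rule sum.cong[OF refl])
    fix v assume "v \<in> {..<Mb}"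
    then show "(\<integral>\<^sup>+\<eta>. G v \<eta> * ennreal (lik u v t b \<eta>) \<partial>noiseM n) = (\<integral>\<^sup>+\<eta>. G v \<eta> \<partial>noiseM n)"
      by (intro nn_integral_noiseM_kernel[of "(t, 10 + b)"] G measurable_compose[OF _ measurable_ennreal] lik_meas u t nn_integral_lik)
         (use t ab_simps in \<open>auto simp: G_def Suc.prems(3) dens_upd lik_upd wide_upd pred_upd\<close>)
  qed
  also have "\<dots> = (\<integral>\<^sup>+\<eta>. (\<Sum>v<Mb. G v \<eta>) \<partial>noiseM n)"
    using G by (intro nn_integral_sum[symmetric]) auto
  also have "\<dots> \<le> (\<integral>\<^sup>+\<eta>. (F \<eta> * ennreal (wide t \<eta>)) * ennreal ((\<Sum>v<Mb. dens u v t \<eta>) * ?w \<eta>) \<partial>noiseM n)"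
  proof (rule nn_integral_mono)
    fix \<eta>
    \<comment> \<open>With the output of \<open>b\<close> gone, the mixture over \<open>v\<close> is
      the predictive density of \<open>a\<close>, which the denominator \<open>pred\<close>
      dominates; the added 1 only makes the cancellation an inequality in the useful
      direction.\<close>
    have "(\<Sum>v<Mb. dens u v t \<eta> * lik u v t a \<eta>) \<le> (\<Sum>v<Mb. dens u v t \<eta>) * pred u t a \<eta>"
      using dens_sum_pos[of u t \<eta>] by (simp add: pred_def field_simps)
    then have "(\<Sum>v<Mb. dens u v t \<eta> * lik u v t a \<eta>) * (?w \<eta> * (wide t \<eta> / pred u t a \<eta>)) \<le>
      ((\<Sum>v<Mb. dens u v t \<eta>) * pred u t a \<eta>) * (?w \<eta> * (wide t \<eta> / pred u t a \<eta>))"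
      by (rule mult_right_mono) (use pos in auto)
    also have "\<dots> = wide t \<eta> * ((\<Sum>v<Mb. dens u v t \<eta>) * ?w \<eta>)"
      using pred_pos[of u t a \<eta>] by simp
    finally have "ennreal ((\<Sum>v<Mb. dens u v t \<eta> * lik u v t a \<eta>) * (?w \<eta> * (wide t \<eta> / pred u t a \<eta>))) \<le>
       ennreal (wide t \<eta>) * ennreal ((\<Sum>v<Mb. dens u v t \<eta>) * ?w \<eta>)"
      using pos by (simp add: ennreal_leI flip: ennreal_mult')
    moreover have "(\<Sum>v<Mb. G v \<eta>) = F \<eta> * ennreal ((\<Sum>v<Mb. dens u v t \<eta> * lik u v t a \<eta>) * (?w \<eta> * (wide t \<eta> / pred u t a \<eta>)))"
      unfolding G_def sum_distrib_left[symmetric]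
      by (simp only: sum_ennreal mult_nonneg_nonneg pos sum_distrib_right mult.assoc)
    ultimately show "(\<Sum>v<Mb. G v \<eta>) \<le> (F \<eta> * ennreal (wide t \<eta>)) * ennreal ((\<Sum>v<Mb. dens u v t \<eta>) * ?w \<eta>)"
      by (simp add: mult.assoc mult_left_mono)
  qed
  \<comment> \<open>The induction hypothesis is used for \<open>F\<close> times
    \<open>wide t\<close>, which still ignores the outputs of \<open>b\<close>; hence the induction
    over arbitrary \<open>F\<close>.\<close>
  also have "\<dots> \<le> of_nat Mb * (\<integral>\<^sup>+\<eta>. (F \<eta> * ennreal (wide t \<eta>)) * ennreal (\<Prod>s<t. wide s \<eta>) \<partial>noiseM n)"
    by (rule Suc.IH, use t in simp, measurable, simp only: Suc.prems(3), subst wide_upd) (use ab_simps in auto)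
  also have "\<dots> = of_nat Mb * (\<integral>\<^sup>+\<eta>. F \<eta> * ennreal (\<Prod>s<Suc t. wide s \<eta>) \<partial>noiseM n)"
    by (intro arg_cong[where f="\<lambda>x. of_nat Mb * x"] nn_integral_cong) (simp add: pos ennreal_mult prod_nonneg mult_ac)
  finally show ?case .
qed

end

section \<open>A Fano inequality for likelihood ratios\<close>

lemma (in prob_space) fano_sum:
  fixes L :: "'i \<Rightarrow> 'a \<Rightarrow> real"
  assumes W: "finite W" and K: "K > 0"
    and pos: "\<And>w x. w \<in> W \<Longrightarrow> L w x > 0"
    and L: "\<And>w. w \<in> W \<Longrightarrow> L w \<in> borel_measurable M"
    and int: "\<And>w. w \<in> W \<Longrightarrow> integrable M (\<lambda>x. ln (L w x))"
    and E: "\<And>w. w \<in> W \<Longrightarrow> E w \<in> sets M"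
    and hit: "(\<Sum>w\<in>W. \<integral>\<^sup>+x. indicator (E w) x * ennreal (L w x) \<partial>M) \<le> ennreal (card W / K)"
    and tot: "(\<Sum>w\<in>W. \<integral>\<^sup>+x. ennreal (L w x) \<partial>M) \<le> ennreal (card W)"
  shows "(\<Sum>w\<in>W. \<integral>x. ln (L w x) \<partial>M) \<le> card W - ln K * (\<Sum>w\<in>W. prob (E w))"
proof -
  have Li: "integrable M (L w)" if w: "w \<in> W" for w
  proof (rule integrableI_nonneg)
    have "(\<integral>\<^sup>+x. ennreal (L w x) \<partial>M) \<le> (\<Sum>w\<in>W. \<integral>\<^sup>+x. ennreal (L w x) \<partial>M)"
      by (rule member_le_sum[OF w]) (auto simp: W)
    also have "\<dots> < \<infinity>" using tot by (simp add: le_less_trans)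
    finally show "(\<integral>\<^sup>+x. ennreal (L w x) \<partial>M) < \<infinity>" .
  qed (use pos[OF w] L[OF w] in \<open>auto intro: less_imp_le\<close>)
  have Ei: "integrable M (\<lambda>x. indicator (E w) x * L w x)" if w: "w \<in> W" for w
    using integrable_mult_indicator[OF E[OF w] Li[OF w]] by simp
  have Pi: "integrable M (indicator (E w) :: _ \<Rightarrow> real)" if w: "w \<in> W" for w
    using E[OF w] by (simp add: emeasure_eq_measure)
  have "ennreal (\<Sum>w\<in>W. \<integral>x. L w x \<partial>M) = (\<Sum>w\<in>W. \<integral>\<^sup>+x. ennreal (L w x) \<partial>M)"
    using Li pos by (simp add: nn_integral_eq_integral less_imp_le sum_ennreal integral_nonneg_AE flip: sum_ennreal)
  with tot have tot': "(\<Sum>w\<in>W. \<integral>x. L w x \<partial>M) \<le> card W"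
    by (metis ennreal_le_iff of_nat_0_le_iff)
  have "ennreal (\<Sum>w\<in>W. \<integral>x. indicator (E w) x * L w x \<partial>M) = (\<Sum>w\<in>W. \<integral>\<^sup>+x. indicator (E w) x * ennreal (L w x) \<partial>M)"
  proof -
    have "(\<integral>\<^sup>+x. indicator (E w) x * ennreal (L w x) \<partial>M) = ennreal (\<integral>x. indicator (E w) x * L w x \<partial>M)" if w: "w \<in> W" for w
    proof -
      have "(\<integral>\<^sup>+x. indicator (E w) x * ennreal (L w x) \<partial>M) = (\<integral>\<^sup>+x. ennreal (indicator (E w) x * L w x) \<partial>M)"
        by (intro nn_integral_cong) (auto simp: indicator_def)
      also have "\<dots> = ennreal (\<integral>x. indicator (E w) x * L w x \<partial>M)"
        using Ei[OF w] pos[OF w] by (intro nn_integral_eq_integral) (auto simp: less_imp_le)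
      finally show ?thesis .
    qed
    then show ?thesis
      using pos by (simp add: integral_nonneg_AE less_imp_le flip: sum_ennreal)
  qed
  with hit have hit': "(\<Sum>w\<in>W. \<integral>x. indicator (E w) x * L w x \<partial>M) \<le> card W / K"
    using K by (metis ennreal_le_iff of_nat_0_le_iff divide_nonneg_pos)
  \<comment> \<open>The bound ln x <= x - 1 is applied to \<open>K * L\<close> on \<open>E w\<close>
    and to \<open>L\<close> off it; the positive terms \<open>L\<close> and \<open>K * L\<close> may
    be added where they do not occur.\<close>
  have "(\<Sum>w\<in>W. \<integral>x. ln (L w x) \<partial>M) \<le>
    (\<Sum>w\<in>W. \<integral>x. K * (indicator (E w) x * L w x) + L w x - ln K * indicator (E w) x - 1 \<partial>M)"
  proof (intro sum_mono integral_mono)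
    fix w x assume w: "w \<in> W"
    have "ln (K * L w x) \<le> K * L w x - 1" "ln (L w x) \<le> L w x - 1"
      using pos[OF w, of x] K by (auto intro!: ln_le_minus_one)
    moreover have "ln (K * L w x) = ln K + ln (L w x)"
      using pos[OF w, of x] K by (simp add: ln_mult)
    ultimately show "ln (L w x) \<le> K * (indicator (E w) x * L w x) + L w x - ln K * indicator (E w) x - 1"
      using pos[OF w, of x] by (cases "x \<in> E w") auto
  qed (use int Ei Li Pi in auto)
  also have "\<dots> = (\<Sum>w\<in>W. K * (\<integral>x. indicator (E w) x * L w x \<partial>M) + (\<integral>x. L w x \<partial>M) - ln K * prob (E w) - 1)"
  proof (rule sum.cong[OF refl])
    fix w assume w: "w \<in> W"
    then have "E w \<inter> space M = E w" using sets.sets_into_space[OF E[OF w]] by auto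
    with w Ei[OF w] Li[OF w] Pi[OF w] show "(\<integral>x. K * (indicator (E w) x * L w x) + L w x - ln K * indicator (E w) x - 1 \<partial>M) =
       K * (\<integral>x. indicator (E w) x * L w x \<partial>M) + (\<integral>x. L w x \<partial>M) - ln K * prob (E w) - 1"
      by (simp add: prob_space)
  qed
  also have "\<dots> = K * (\<Sum>w\<in>W. \<integral>x. indicator (E w) x * L w x \<partial>M) + (\<Sum>w\<in>W. \<integral>x. L w x \<partial>M)
       - ln K * (\<Sum>w\<in>W. prob (E w)) - card W"
    by (simp add: sum.distrib sum_subtractf sum_distrib_left)
  also have "K * (\<Sum>w\<in>W. \<integral>x. indicator (E w) x * L w x \<partial>M) \<le> card W"
    using hit' K by (simp add: field_simps)
  finally show ?thesis using tot' by simp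
qed

section \<open>Symmetry of the two outputs within one slot\<close>

context relay_broadcast
begin

text \<open>Here the delay of the feedback enters: relay signals of slot \<open>t\<close> are fixed
  without the second-hop coefficients and noises of that slot.\<close>

lemma xt_swap: "xt u v t j (swap_receivers t \<eta>) = xt u v t j \<eta>"
  by (simp add: swap_receivers_def xt_upd)

lemma mean_swap: "mean u v t a (swap_receivers t \<eta>) = mean u v t b \<eta>" "mean u v t b (swap_receivers t \<eta>) = mean u v t a \<eta>"
  unfolding mean_def xt_swap using ab by (auto simp: Gc_def swap_receivers_def)

lemma swap_out: "swap_receivers t \<eta> (t, 10 + a) = \<eta> (t, 10 + b)" "swap_receivers t \<eta> (t, 10 + b) = \<eta> (t, 10 + a)"
  using ab by (auto simp: swap_receivers_def)

lemma lik_swap: "lik u v t a (swap_receivers t \<eta>) = lik u v t b \<eta>"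
  by (simp add: lik_def mean_swap swap_out)

lemma dens_swap: "dens u v t (swap_receivers t \<eta>) = dens u v t \<eta>"
  by (simp add: swap_receivers_def dens_upd)

lemma pred_swap: "pred u t a (swap_receivers t \<eta>) = pred u t b \<eta>"
  by (simp add: pred_def lik_swap dens_swap)

lemma shift_swap: "shift u v t (swap_receivers t \<eta>) = swap_receivers t (shift u v t \<eta>)"
  unfolding shift_def mean_swap swap_out using ab by (auto simp: swap_receivers_def fun_eq_iff)

lemma outp_future: "t \<le> s \<Longrightarrow> outp u v t \<eta> (s, k) = \<eta> (s, k)"
  by (induction t) (auto simp: shift_def)

lemma outp_inputs: "k < 10 \<Longrightarrow> outp u v t \<eta> (s, k) = \<eta> (s, k)"
  by (induction t) (auto simp: shift_def)

text \<open>Stops at \<open>Suc t\<close>, because from the next slot on the relays may react to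
  what was exchanged.\<close>

lemma outp_swap: "outp u v (Suc t) (swap_receivers t \<eta>) = swap_receivers t (outp u v (Suc t) \<eta>)"
proof -
  have "outp u v t (swap_receivers t \<eta>) = swap_receivers t (outp u v t \<eta>)"
    by (simp add: swap_receivers_def outp_upd outp_future)
  then show ?thesis by (simp add: shift_swap)
qed

text \<open>Each step of \<open>outp\<close> changes outputs of its own slot only. This carries
  quantities from the full output sample back to the stage at which their slot is reached.\<close>

lemma outp_later:
  assumes "\<And>s z \<eta>. t \<le> s \<Longrightarrow> F (\<eta>((s, 10 + a) := z)) = F \<eta>" "\<And>s z \<eta>. t \<le> s \<Longrightarrow> F (\<eta>((s, 10 + b) := z)) = F \<eta>"
    and "t \<le> m"
  shows "F (outp u v m \<eta>) = F (outp u v t \<eta>)"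
  using assms(3)
proof (induction rule: dec_induct)
  case (step k)
  then show ?case
    unfolding outp.simps shift_def by (simp only: assms(1,2))
qed simp

lemma xt_outp: "t \<le> m \<Longrightarrow> xt u v t j (outp u v m \<eta>) = xt u v t j (outp u v t \<eta>)"
  by (rule outp_later) (auto simp del: fun_upd_apply intro!: xt_upd)

lemma mean_outp: "t \<le> m \<Longrightarrow> i < 2 \<Longrightarrow> mean u v t i (outp u v m \<eta>) = mean u v t i (outp u v t \<eta>)"
  by (rule outp_later) (auto simp del: fun_upd_apply intro!: mean_upd)

lemma outp_eq: "t < m \<Longrightarrow> i < 2 \<Longrightarrow> outp u v m \<eta> (t, 10 + i) = \<eta> (t, 10 + i) + mean u v t i (outp u v m \<eta>)"
proof -
  assume tm: "t < m" and i: "i < 2"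
  have "outp u v m \<eta> (t, 10 + i) = outp u v (Suc t) \<eta> (t, 10 + i)"
    by (rule outp_later) (use tm in auto)
  moreover have "i = a \<or> i = b" using i ab by auto
  ultimately show ?thesis using tm i ab_simps by (auto simp: shift_def outp_future mean_outp[of t m])
qed

lemma pred_outp: "t < m \<Longrightarrow> i < 2 \<Longrightarrow> pred u t i (outp u v m \<eta>) = pred u t i (outp u v (Suc t) \<eta>)"
  by (rule outp_later) (auto simp del: fun_upd_apply intro!: pred_upd)

lemma outp_out: "t < m \<Longrightarrow> outp u v m \<eta> (t, k) = outp u v (Suc t) \<eta> (t, k)"
  by (rule outp_later) auto

text \<open>Relative to Lebesgue measure, \<open>pred\<close> acquires the factor exp(-|y|^2) / pi,
  so the integrand is, up to a constant, minus the logarithm of a Lebesgue density of the received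
  symbol. The two destinations are statistically equivalent given the past, hence equal
  integrals.\<close>

lemma integral_swap_ab:
  assumes uv: "u < Ma" "v < Mb" and t: "t < n"
  shows "(\<integral>\<eta>. (cmod (outp u v n \<eta> (t, 10 + a)))\<^sup>2 - ln (pred u t a (outp u v n \<eta>)) \<partial>noiseM n) =
         (\<integral>\<eta>. (cmod (outp u v n \<eta> (t, 10 + b)))\<^sup>2 - ln (pred u t b (outp u v n \<eta>)) \<partial>noiseM n)"
proof -
  define \<psi> where "\<psi> i \<eta> = (cmod (outp u v (Suc t) \<eta> (t, 10 + i)))\<^sup>2 - ln (pred u t i (outp u v (Suc t) \<eta>))" for i \<eta>
  have eq: "(cmod (outp u v n \<eta> (t, 10 + i)))\<^sup>2 - ln (pred u t i (outp u v n \<eta>)) = \<psi> i \<eta>" if "i < 2" for i \<eta>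
    unfolding \<psi>_def outp_out[OF t] pred_outp[OF t that] ..
  have om: "outp u v (Suc t) \<in> measurable (noiseM n) (noiseM n)"
    using outp_meas[OF uv, of "Suc t"] t by simp
  have "\<psi> a \<in> borel_measurable (noiseM n)"
    using measurable_compose[OF om pred_meas[OF uv(1) t ab_simps(1)]]
      measurable_compose[OF om noiseM_component[OF slot_mem(1)[OF t]]]
    unfolding \<psi>_def by measurable
  then have "(\<integral>\<eta>. \<psi> a (swap_receivers t \<eta>) \<partial>noiseM n) = (\<integral>\<eta>. \<psi> a \<eta> \<partial>noiseM n)"
    by (rule integral_swap_receivers[OF t])
  moreover have "\<psi> a (swap_receivers t \<eta>) = \<psi> b \<eta>" for \<eta>
    unfolding \<psi>_def outp_swap by (simp only: swap_out pred_swap)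
  ultimately show ?thesis by (simp only: eq ab_simps)
qed

section \<open>Moment bounds and integrability\<close>

lemma pred_le: "pred u t i \<eta> \<le> 2 * exp ((cmod (\<eta> (t, 10 + i)))\<^sup>2)"
proof -
  let ?e = "exp ((cmod (\<eta> (t, 10 + i)))\<^sup>2)"
  have "(\<Sum>v<Mb. dens u v t \<eta> * lik u v t i \<eta>) \<le> (\<Sum>v<Mb. dens u v t \<eta> * ?e)"
    by (intro sum_mono mult_left_mono) (auto simp: lik_def less_imp_le[OF dens_pos])
  also have "\<dots> = (\<Sum>v<Mb. dens u v t \<eta>) * ?e" by (simp add: sum_distrib_right)
  finally have "pred u t i \<eta> \<le> 1 + ?e"
    using dens_sum_pos[of u t \<eta>] by (simp add: pred_def field_simps)
  also have "1 \<le> ?e" by simp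
  finally show ?thesis by simp
qed

text \<open>Makes \<open>ln pred\<close> integrable as soon as the output has a finite second
  moment. The lower bound 0 is what the added 1 in \<open>pred\<close> provides.\<close>

lemma ln_pred_bounds: "0 \<le> ln (pred u t i \<eta>)" "ln (pred u t i \<eta>) \<le> ln 2 + (cmod (\<eta> (t, 10 + i)))\<^sup>2"
proof -
  show "0 \<le> ln (pred u t i \<eta>)" using pred_ge_1 by simp
  have "ln (pred u t i \<eta>) \<le> ln (2 * exp ((cmod (\<eta> (t, 10 + i)))\<^sup>2))"
    using pred_le pred_pos by simp
  then show "ln (pred u t i \<eta>) \<le> ln 2 + (cmod (\<eta> (t, 10 + i)))\<^sup>2" by (simp add: ln_mult)
qed

lemma nn_integral_component: "c \<in> slots n \<Longrightarrow> (\<integral>\<^sup>+\<eta>. ennreal ((cmod (\<eta> c))\<^sup>2) \<partial>noiseM n) = 1"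
  using nn_integral_noiseM_kernel[of c n "\<lambda>_. 1" "\<lambda>\<eta>. ennreal ((cmod (\<eta> c))\<^sup>2)"]
    prob_space.emeasure_space_1[OF prob_space_noiseM] by (simp add: CN01_second_moment)

text \<open>Relay signals of slot \<open>t\<close> are independent of the second-hop coefficients of
  that slot, which have unit second moment. The 3 comes from (p + q + r)^2 <= 3 (p^2 + q^2 +
  r^2).\<close>

lemma second_moment_out:
  assumes uv: "u < Ma" "v < Mb" and t: "t < n" and i: "i < 2"
  shows "(\<integral>\<^sup>+\<eta>. ennreal ((cmod (outp u v n \<eta> (t, 10 + i)))\<^sup>2) \<partial>noiseM n) \<le>
    3 * ((\<integral>\<^sup>+\<eta>. ennreal ((cmod (xt u v t 0 (outp u v n \<eta>)))\<^sup>2) \<partial>noiseM n) +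
         (\<integral>\<^sup>+\<eta>. ennreal ((cmod (xt u v t 1 (outp u v n \<eta>)))\<^sup>2) \<partial>noiseM n) + 1)"
proof -
  have om: "outp u v n \<in> measurable (noiseM n) (noiseM n)" using outp_meas[OF uv] by simp
  define X where "X j \<eta> = xt u v t j (outp u v n \<eta>)" for j \<eta>
  have Xm: "X j \<in> borel_measurable (noiseM n)" if "j < 2" for j
    unfolding X_def using measurable_compose[OF om xt_meas[OF uv t that]] .
  have Xu: "X j (\<eta>((t, k) := z)) = X j \<eta>" if "4 \<le> k" for j \<eta> k z
    unfolding X_def xt_outp[OF less_imp_le[OF t]] outp_upd[OF order_refl] using that by (intro xt_upd) auto
  let ?g = "\<lambda>j \<eta>. \<eta> (t, 4 + 2 * i + j)"
  have gc: "(t, 4 + 2 * i + j) \<in> slots n" if "j < 2" for j using t i that by auto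
  have gX: "(\<integral>\<^sup>+\<eta>. ennreal ((cmod (X j \<eta>))\<^sup>2) * ennreal ((cmod (?g j \<eta>))\<^sup>2) \<partial>noiseM n) =
      (\<integral>\<^sup>+\<eta>. ennreal ((cmod (X j \<eta>))\<^sup>2) \<partial>noiseM n)" if j: "j < 2" for j
    by (rule nn_integral_noiseM_kernel[OF gc[OF j]])
       (use Xm[OF j] noiseM_component[OF gc[OF j]] in \<open>simp_all add: Xu CN01_second_moment\<close>)
  have "(\<integral>\<^sup>+\<eta>. ennreal ((cmod (outp u v n \<eta> (t, 10 + i)))\<^sup>2) \<partial>noiseM n) \<le>
    (\<integral>\<^sup>+\<eta>. 3 * (ennreal ((cmod (X 0 \<eta>))\<^sup>2) * ennreal ((cmod (?g 0 \<eta>))\<^sup>2) +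
         ennreal ((cmod (X 1 \<eta>))\<^sup>2) * ennreal ((cmod (?g 1 \<eta>))\<^sup>2) + ennreal ((cmod (\<eta> (t, 10 + i)))\<^sup>2)) \<partial>noiseM n)"
  proof (rule nn_integral_mono)
    fix \<eta>
    have y: "outp u v n \<eta> (t, 10 + i) = ?g 0 \<eta> * X 0 \<eta> + ?g 1 \<eta> * X 1 \<eta> + \<eta> (t, 10 + i)"
      using outp_eq[OF t i, of u v \<eta>] i by (simp add: mean_def Gc_def X_def outp_inputs)
    have sq: "(p + q + r)\<^sup>2 \<le> 3 * (p\<^sup>2 + q\<^sup>2 + r\<^sup>2)" for p q r :: real
      using sum_squares_bound[of p q] sum_squares_bound[of p r] sum_squares_bound[of q r]
      by (simp add: power2_eq_square algebra_simps)
    have "cmod (outp u v n \<eta> (t, 10 + i)) \<le> cmod (?g 0 \<eta> * X 0 \<eta>) + cmod (?g 1 \<eta> * X 1 \<eta>) + cmod (\<eta> (t, 10 + i))"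
      unfolding y by (meson add_right_mono norm_triangle_ineq order_trans)
    then have "(cmod (outp u v n \<eta> (t, 10 + i)))\<^sup>2 \<le> (cmod (?g 0 \<eta> * X 0 \<eta>) + cmod (?g 1 \<eta> * X 1 \<eta>) + cmod (\<eta> (t, 10 + i)))\<^sup>2"
      by (rule power_mono) simp
    also have "\<dots> \<le> 3 * ((cmod (?g 0 \<eta> * X 0 \<eta>))\<^sup>2 + (cmod (?g 1 \<eta> * X 1 \<eta>))\<^sup>2 + (cmod (\<eta> (t, 10 + i)))\<^sup>2)"
      by (rule sq)
    also have "\<dots> = 3 * ((cmod (X 0 \<eta>))\<^sup>2 * (cmod (?g 0 \<eta>))\<^sup>2 + (cmod (X 1 \<eta>))\<^sup>2 * (cmod (?g 1 \<eta>))\<^sup>2 + (cmod (\<eta> (t, 10 + i)))\<^sup>2)"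
      by (simp add: norm_mult power_mult_distrib mult.commute)
    finally have "ennreal ((cmod (outp u v n \<eta> (t, 10 + i)))\<^sup>2) \<le> ennreal (3 * ((cmod (X 0 \<eta>))\<^sup>2 * (cmod (?g 0 \<eta>))\<^sup>2 + (cmod (X 1 \<eta>))\<^sup>2 * (cmod (?g 1 \<eta>))\<^sup>2 + (cmod (\<eta> (t, 10 + i)))\<^sup>2))"
      by (rule ennreal_leI)
    then show "ennreal ((cmod (outp u v n \<eta> (t, 10 + i)))\<^sup>2) \<le> 3 * (ennreal ((cmod (X 0 \<eta>))\<^sup>2) * ennreal ((cmod (?g 0 \<eta>))\<^sup>2) +
         ennreal ((cmod (X 1 \<eta>))\<^sup>2) * ennreal ((cmod (?g 1 \<eta>))\<^sup>2) + ennreal ((cmod (\<eta> (t, 10 + i)))\<^sup>2))"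
      by (simp add: ennreal_mult ennreal_plus)
  qed
  also have "\<dots> = 3 * ((\<integral>\<^sup>+\<eta>. ennreal ((cmod (X 0 \<eta>))\<^sup>2) \<partial>noiseM n) + (\<integral>\<^sup>+\<eta>. ennreal ((cmod (X 1 \<eta>))\<^sup>2) \<partial>noiseM n) + 1)"
  proof -
    have c: "(t, 10 + i) \<in> slots n" using t i by auto
    have m: "(\<lambda>\<eta>. ennreal ((cmod (X j \<eta>))\<^sup>2) * ennreal ((cmod (?g j \<eta>))\<^sup>2)) \<in> borel_measurable (noiseM n)" if j: "j < 2" for j
      using Xm[OF j] noiseM_component[OF gc[OF j]] by measurable
    have m': "(\<lambda>\<eta>. ennreal ((cmod (\<eta> (t, 10 + i)))\<^sup>2)) \<in> borel_measurable (noiseM n)"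
      using noiseM_component[OF c] by measurable
    have j: "(0::nat) < 2" "(1::nat) < 2" by auto
    show ?thesis
      by (simp only: nn_integral_cmult nn_integral_add borel_measurable_add m[OF j(1)] m[OF j(2)] m' gX[OF j(1)] gX[OF j(2)] nn_integral_component[OF c])
  qed
  finally show ?thesis by (simp add: X_def)
qed

end

section \<open>The two likelihood ratios and the broadcast bound\<close>

lemma ln_prod_pos:
  fixes f :: "'a \<Rightarrow> real"
  shows "finite I \<Longrightarrow> (\<And>i. i \<in> I \<Longrightarrow> f i > 0) \<Longrightarrow> ln (prod f I) = (\<Sum>i\<in>I. ln (f i))"
  by (rule ln_prod) (auto simp: less_imp_neq[symmetric])

context relay_broadcast
begin

text \<open>First comparison law against the true law: each factor replaces the predictive density
  of an output of \<open>a\<close> by \<open>wide\<close> and leaves the law of \<open>b\<close>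
  given \<open>a\<close> in place.\<close>

definition ratio_a :: "nat \<times> nat \<Rightarrow> (nat \<times> nat \<Rightarrow> complex) \<Rightarrow> real" where
  "ratio_a w \<eta> = (\<Prod>t<n. wide t \<eta> / pred (fst w) t a \<eta>)"

text \<open>Second comparison law against the true law: independent outputs drawn from
  \<open>pred / 2\<close>, divided by the true density.\<close>

definition ratio_b :: "nat \<times> nat \<Rightarrow> (nat \<times> nat \<Rightarrow> complex) \<Rightarrow> real" where
  "ratio_b w \<eta> = (\<Prod>t<n. pred (fst w) t a \<eta> / 2 * (pred (fst w) t b \<eta> / 2)) / dens (fst w) (snd w) n \<eta>"

lemma ratio_a_pos: "ratio_a w \<eta> > 0"
  unfolding ratio_a_def by (intro prod_pos ballI divide_pos_pos wide_pos pred_pos)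

lemma ratio_b_pos: "ratio_b w \<eta> > 0"
  unfolding ratio_b_def by (intro divide_pos_pos prod_pos ballI mult_pos_pos pred_pos dens_pos) auto

lemma ratio_a_meas: "fst w < Ma \<Longrightarrow> ratio_a w \<in> borel_measurable (noiseM n)"
  unfolding ratio_a_def by (intro borel_measurable_prod borel_measurable_divide wide_meas pred_meas) (auto simp: ab_simps)

lemma ratio_b_meas: "fst w < Ma \<Longrightarrow> snd w < Mb \<Longrightarrow> ratio_b w \<in> borel_measurable (noiseM n)"
  unfolding ratio_b_def by (intro borel_measurable_prod borel_measurable_times borel_measurable_divide dens_meas pred_meas) (auto simp: ab_simps)

text \<open>Only the sum over \<open>v\<close> produces the mixture that the factors
  \<open>pred\<close> divide out; hence a bound for the sum over the messages of
  \<open>b\<close>.\<close>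

lemma nn_integral_ratio_a:
  assumes u: "u < Ma" and F: "F \<in> borel_measurable (noiseM n)"
    and inv: "\<And>s \<eta> z. F (\<eta>((s, 10 + b) := z)) = F \<eta>"
  shows "(\<Sum>v<Mb. \<integral>\<^sup>+\<eta>. F (outp u v n \<eta>) * ennreal (ratio_a (u, v) (outp u v n \<eta>)) \<partial>noiseM n)
     \<le> of_nat Mb * (\<integral>\<^sup>+\<eta>. F \<eta> * ennreal (\<Prod>s<n. wide s \<eta>) \<partial>noiseM n)"
proof -
  define w where "w \<eta> = (\<Prod>s<n. wide s \<eta> / pred u s a \<eta>)" for \<eta>
  have w: "w \<in> borel_measurable (noiseM n)"
    using ratio_a_meas[of "(u, 0)"] u unfolding ratio_a_def w_def by simp
  have wp: "w \<eta> \<ge> 0" for \<eta>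
    using ratio_a_pos[of "(u, 0)"] by (simp add: ratio_a_def w_def less_imp_le)
  note [measurable] = F w
  have "(\<Sum>v<Mb. \<integral>\<^sup>+\<eta>. F (outp u v n \<eta>) * ennreal (ratio_a (u, v) (outp u v n \<eta>)) \<partial>noiseM n) =
    (\<Sum>v<Mb. \<integral>\<^sup>+\<eta>. F \<eta> * ennreal (dens u v n \<eta> * w \<eta>) \<partial>noiseM n)"
  proof (rule sum.cong[OF refl])
    fix v assume "v \<in> {..<Mb}"
    then have v: "v < Mb" by simp
    have "(\<integral>\<^sup>+\<eta>. F (outp u v n \<eta>) * ennreal (ratio_a (u, v) (outp u v n \<eta>)) \<partial>noiseM n) =
       (\<integral>\<^sup>+\<eta>. (\<lambda>\<eta>. F \<eta> * ennreal (w \<eta>)) (outp u v n \<eta>) \<partial>noiseM n)"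
      by (simp add: ratio_a_def w_def)
    also have "\<dots> = (\<integral>\<^sup>+\<eta>. F \<eta> * ennreal (w \<eta>) * ennreal (dens u v n \<eta>) \<partial>noiseM n)"
      by (rule nn_integral_outp[OF u v order_refl]) measurable
    also have "\<dots> = (\<integral>\<^sup>+\<eta>. F \<eta> * ennreal (dens u v n \<eta> * w \<eta>) \<partial>noiseM n)"
      using wp dens_pos by (intro nn_integral_cong) (simp add: ennreal_mult less_imp_le mult_ac)
    finally show "(\<integral>\<^sup>+\<eta>. F (outp u v n \<eta>) * ennreal (ratio_a (u, v) (outp u v n \<eta>)) \<partial>noiseM n) =
      (\<integral>\<^sup>+\<eta>. F \<eta> * ennreal (dens u v n \<eta> * w \<eta>) \<partial>noiseM n)" .
  qed
  also have "\<dots> = (\<integral>\<^sup>+\<eta>. (\<Sum>v<Mb. F \<eta> * ennreal (dens u v n \<eta> * w \<eta>)) \<partial>noiseM n)"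
    using dens_meas[OF u _ order_refl]
    by (intro nn_integral_sum[symmetric] borel_measurable_times_ennreal F measurable_compose[OF _ measurable_ennreal] borel_measurable_times w) auto
  also have "\<dots> = (\<integral>\<^sup>+\<eta>. F \<eta> * ennreal ((\<Sum>v<Mb. dens u v n \<eta>) * w \<eta>) \<partial>noiseM n)"
    unfolding sum_distrib_left[symmetric]
    by (simp only: sum_ennreal mult_nonneg_nonneg wp less_imp_le[OF dens_pos] sum_distrib_right)
  also have "\<dots> \<le> of_nat Mb * (\<integral>\<^sup>+\<eta>. F \<eta> * ennreal (\<Prod>s<n. wide s \<eta>) \<partial>noiseM n)"
    unfolding w_def by (rule nn_integral_weak_receiver[OF u order_refl F inv])
  finally show ?thesis .
qed

lemma nn_integral_ratio_b:
  assumes u: "u < Ma" and v: "v < Mb" and F: "F \<in> borel_measurable (noiseM n)"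
  shows "(\<integral>\<^sup>+\<eta>. F (outp u v n \<eta>) * ennreal (ratio_b (u, v) (outp u v n \<eta>)) \<partial>noiseM n)
     = (\<integral>\<^sup>+\<eta>. F \<eta> * ennreal (\<Prod>s<n. pred u s a \<eta> / 2 * (pred u s b \<eta> / 2)) \<partial>noiseM n)"
proof -
  have [measurable]: "ratio_b (u, v) \<in> borel_measurable (noiseM n)" using u v ratio_b_meas by simp
  note [measurable] = F
  have "(\<integral>\<^sup>+\<eta>. (\<lambda>\<eta>. F \<eta> * ennreal (ratio_b (u, v) \<eta>)) (outp u v n \<eta>) \<partial>noiseM n) =
     (\<integral>\<^sup>+\<eta>. F \<eta> * ennreal (ratio_b (u, v) \<eta>) * ennreal (dens u v n \<eta>) \<partial>noiseM n)"
    by (rule nn_integral_outp[OF u v order_refl]) measurable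
  also have "\<dots> = (\<integral>\<^sup>+\<eta>. F \<eta> * ennreal (\<Prod>s<n. pred u s a \<eta> / 2 * (pred u s b \<eta> / 2)) \<partial>noiseM n)"
  proof (rule nn_integral_cong)
    fix \<eta>
    have "ratio_b (u, v) \<eta> * dens u v n \<eta> = (\<Prod>s<n. pred u s a \<eta> / 2 * (pred u s b \<eta> / 2))"
      using dens_pos[of u v n \<eta>] unfolding ratio_b_def by simp
    then show "F \<eta> * ennreal (ratio_b (u, v) \<eta>) * ennreal (dens u v n \<eta>) = F \<eta> * ennreal (\<Prod>s<n. pred u s a \<eta> / 2 * (pred u s b \<eta> / 2))"
      using ennreal_mult[OF less_imp_le[OF ratio_b_pos] less_imp_le[OF dens_pos], of "(u, v)" \<eta> u v n \<eta>] by (simp add: mult.assoc)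
  qed
  finally show ?thesis by simp
qed

definition hit_a :: "nat \<times> nat \<Rightarrow> (nat \<times> nat \<Rightarrow> complex) set" where
  "hit_a w = {\<eta> \<in> space (noiseM n). \<delta>a (outp (fst w) (snd w) n \<eta>) = fst w}"

definition hit_b :: "nat \<times> nat \<Rightarrow> (nat \<times> nat \<Rightarrow> complex) set" where
  "hit_b w = {\<eta> \<in> space (noiseM n). \<delta>b (outp (fst w) (snd w) n \<eta>) = snd w}"

lemma hit_a_eq:
  assumes "u < Ma" "v < Mb"
  shows "hit_a (u, v) = outp u v n -` {\<eta> \<in> space (noiseM n). \<delta>a \<eta> = u} \<inter> space (noiseM n)"
  using measurable_space[OF outp_meas[OF assms order_refl]] by (auto simp: hit_a_def)

lemma hit_b_eq:
  assumes "u < Ma" "v < Mb"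
  shows "hit_b (u, v) = outp u v n -` {\<eta> \<in> space (noiseM n). \<delta>b \<eta> = v} \<inter> space (noiseM n)"
  using measurable_space[OF outp_meas[OF assms order_refl]] by (auto simp: hit_b_def)

lemma hit_sets:
  assumes "u < Ma" "v < Mb"
  shows "hit_a (u, v) \<in> sets (noiseM n)" "hit_b (u, v) \<in> sets (noiseM n)"
  unfolding hit_a_eq[OF assms] hit_b_eq[OF assms]
  by (intro measurable_sets[OF outp_meas[OF assms order_refl]] \<delta>a_meas \<delta>b_meas assms)+

lemma sum_disjoint_indicators:
  fixes D :: "'x \<Rightarrow> nat" and c :: ennreal
  shows "(\<Sum>k<(K::nat). indicator {x. D x = k} y * c) \<le> c"
proof -
  have "(\<Sum>k<K. indicator {x. D x = k} y * c) = (\<Sum>k<K. if k = D y then c else 0)"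
    by (intro sum.cong) auto
  then show ?thesis by simp
qed

text \<open>The decoder of \<open>a\<close> ignores the outputs of \<open>b\<close>, and the
  remaining law of the outputs of \<open>a\<close>, a product of \<open>wide\<close>, does not
  depend on \<open>u\<close>. Decoding events for different \<open>u\<close> are disjoint, so the
  total is at most \<open>Mb\<close>, the number of pairs divided by \<open>Ma\<close>.\<close>

lemma hit_a_bound:
  "(\<Sum>w\<in>{..<Ma} \<times> {..<Mb}. \<integral>\<^sup>+\<eta>. indicator (hit_a w) \<eta> * ennreal (ratio_a w (outp (fst w) (snd w) n \<eta>)) \<partial>noiseM n)
     \<le> ennreal (real (card ({..<Ma} \<times> {..<Mb})) / real Ma)"
proof -
  have m: "(\<lambda>\<eta>. indicator {\<eta>. \<delta>a \<eta> = u} \<eta> :: ennreal) \<in> borel_measurable (noiseM n)" if "u < Ma" for u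
  proof -
    have "(indicator {\<eta> \<in> space (noiseM n). \<delta>a \<eta> = u} :: _ \<Rightarrow> ennreal) \<in> borel_measurable (noiseM n)"
      using \<delta>a_meas[OF that] by simp
    then show ?thesis
      by (rule measurable_cong[THEN iffD1, rotated]) (auto simp: indicator_def)
  qed
  have wm: "(\<lambda>\<eta>. ennreal (\<Prod>s<n. wide s \<eta>)) \<in> borel_measurable (noiseM n)"
    by (intro measurable_compose[OF _ measurable_ennreal] borel_measurable_prod wide_meas) auto
  have "(\<Sum>w\<in>{..<Ma} \<times> {..<Mb}. \<integral>\<^sup>+\<eta>. indicator (hit_a w) \<eta> * ennreal (ratio_a w (outp (fst w) (snd w) n \<eta>)) \<partial>noiseM n)
    = (\<Sum>u<Ma. \<Sum>v<Mb. \<integral>\<^sup>+\<eta>. indicator {\<eta>. \<delta>a \<eta> = u} (outp u v n \<eta>) * ennreal (ratio_a (u, v) (outp u v n \<eta>)) \<partial>noiseM n)"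
    unfolding sum.cartesian_product by (auto intro!: sum.cong nn_integral_cong simp: hit_a_def indicator_def)
  also have "\<dots> \<le> (\<Sum>u<Ma. of_nat Mb * (\<integral>\<^sup>+\<eta>. indicator {\<eta>. \<delta>a \<eta> = u} \<eta> * ennreal (\<Prod>s<n. wide s \<eta>) \<partial>noiseM n))"
    using m \<delta>a_upd by (intro sum_mono nn_integral_ratio_a) (simp_all add: indicator_def)
  also have "\<dots> = of_nat Mb * (\<integral>\<^sup>+\<eta>. (\<Sum>u<Ma. indicator {\<eta>. \<delta>a \<eta> = u} \<eta> * ennreal (\<Prod>s<n. wide s \<eta>)) \<partial>noiseM n)"
    using m wm by (subst nn_integral_sum) (auto simp: sum_distrib_left)
  also have "\<dots> \<le> of_nat Mb * (\<integral>\<^sup>+\<eta>. ennreal (\<Prod>s<n. wide s \<eta>) \<partial>noiseM n)"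
    by (intro mult_left_mono nn_integral_mono sum_disjoint_indicators) auto
  also have "\<dots> = ennreal (real (card ({..<Ma} \<times> {..<Mb})) / real Ma)"
    using Ma_pos by (simp add: nn_integral_prod_wide card_cartesian_product ennreal_of_nat_eq_real_of_nat)
  finally show ?thesis .
qed

lemma ratio_a_bound:
  "(\<Sum>w\<in>{..<Ma} \<times> {..<Mb}. \<integral>\<^sup>+\<eta>. ennreal (ratio_a w (outp (fst w) (snd w) n \<eta>)) \<partial>noiseM n)
     \<le> ennreal (real (card ({..<Ma} \<times> {..<Mb})))"
proof -
  have "(\<Sum>w\<in>{..<Ma} \<times> {..<Mb}. \<integral>\<^sup>+\<eta>. ennreal (ratio_a w (outp (fst w) (snd w) n \<eta>)) \<partial>noiseM n)
    = (\<Sum>u<Ma. \<Sum>v<Mb. \<integral>\<^sup>+\<eta>. (\<lambda>_. 1) (outp u v n \<eta>) * ennreal (ratio_a (u, v) (outp u v n \<eta>)) \<partial>noiseM n)"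
    unfolding sum.cartesian_product by (intro sum.cong refl) auto
  also have "\<dots> \<le> (\<Sum>u<Ma. of_nat Mb * (\<integral>\<^sup>+\<eta>. 1 * ennreal (\<Prod>s<n. wide s \<eta>) \<partial>noiseM n))"
    by (intro sum_mono nn_integral_ratio_a) simp_all
  also have "\<dots> = ennreal (real (card ({..<Ma} \<times> {..<Mb})))"
    by (simp add: nn_integral_prod_wide card_cartesian_product ennreal_of_nat_eq_real_of_nat ennreal_mult)
  finally show ?thesis .
qed

text \<open>The second comparison law depends on \<open>u\<close> but not on \<open>v\<close>, so
  for fixed \<open>u\<close> the disjoint decoding events of \<open>b\<close> have total mass at
  most 1. The decoder of \<open>b\<close> may read both outputs here.\<close>

lemma hit_b_bound:
  "(\<Sum>w\<in>{..<Ma} \<times> {..<Mb}. \<integral>\<^sup>+\<eta>. indicator (hit_b w) \<eta> * ennreal (ratio_b w (outp (fst w) (snd w) n \<eta>)) \<partial>noiseM n)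
     \<le> ennreal (real (card ({..<Ma} \<times> {..<Mb})) / real Mb)"
proof -
  have m: "(\<lambda>\<eta>. indicator {\<eta>. \<delta>b \<eta> = v} \<eta> :: ennreal) \<in> borel_measurable (noiseM n)" if "v < Mb" for v
  proof -
    have "(indicator {\<eta> \<in> space (noiseM n). \<delta>b \<eta> = v} :: _ \<Rightarrow> ennreal) \<in> borel_measurable (noiseM n)"
      using \<delta>b_meas[OF that] by simp
    then show ?thesis
      by (rule measurable_cong[THEN iffD1, rotated]) (auto simp: indicator_def)
  qed
  let ?p = "\<lambda>u \<eta>. ennreal (\<Prod>s<n. pred u s a \<eta> / 2 * (pred u s b \<eta> / 2))"
  have pm: "?p u \<in> borel_measurable (noiseM n)" if "u < Ma" for u
    using that ab_simps by (intro measurable_compose[OF _ measurable_ennreal] borel_measurable_prod borel_measurable_times borel_measurable_divide pred_meas) auto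
  have "(\<Sum>w\<in>{..<Ma} \<times> {..<Mb}. \<integral>\<^sup>+\<eta>. indicator (hit_b w) \<eta> * ennreal (ratio_b w (outp (fst w) (snd w) n \<eta>)) \<partial>noiseM n)
    = (\<Sum>u<Ma. \<Sum>v<Mb. \<integral>\<^sup>+\<eta>. indicator {\<eta>. \<delta>b \<eta> = v} (outp u v n \<eta>) * ennreal (ratio_b (u, v) (outp u v n \<eta>)) \<partial>noiseM n)"
    unfolding sum.cartesian_product by (auto intro!: sum.cong nn_integral_cong simp: hit_b_def indicator_def)
  also have "\<dots> = (\<Sum>u<Ma. \<Sum>v<Mb. \<integral>\<^sup>+\<eta>. indicator {\<eta>. \<delta>b \<eta> = v} \<eta> * ?p u \<eta> \<partial>noiseM n)"
    using m by (intro sum.cong refl nn_integral_ratio_b) auto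
  also have "\<dots> = (\<Sum>u<Ma. \<integral>\<^sup>+\<eta>. (\<Sum>v<Mb. indicator {\<eta>. \<delta>b \<eta> = v} \<eta> * ?p u \<eta>) \<partial>noiseM n)"
    using m pm by (intro sum.cong refl nn_integral_sum[symmetric] borel_measurable_times_ennreal) auto
  also have "\<dots> \<le> (\<Sum>u<Ma. \<integral>\<^sup>+\<eta>. ?p u \<eta> \<partial>noiseM n)"
    by (intro sum_mono nn_integral_mono sum_disjoint_indicators)
  also have "\<dots> = ennreal (real (card ({..<Ma} \<times> {..<Mb})) / real Mb)"
    using Mb_pos nn_integral_prod_pred[OF _ order_refl] by (simp add: card_cartesian_product ennreal_of_nat_eq_real_of_nat)
  finally show ?thesis .
qed

lemma ratio_b_bound:
  "(\<Sum>w\<in>{..<Ma} \<times> {..<Mb}. \<integral>\<^sup>+\<eta>. ennreal (ratio_b w (outp (fst w) (snd w) n \<eta>)) \<partial>noiseM n)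
     \<le> ennreal (real (card ({..<Ma} \<times> {..<Mb})))"
proof -
  have "(\<integral>\<^sup>+\<eta>. ennreal (ratio_b (u, v) (outp u v n \<eta>)) \<partial>noiseM n) = 1" if "u < Ma" "v < Mb" for u v
    using nn_integral_ratio_b[OF that, of "\<lambda>_. 1"] nn_integral_prod_pred[OF that(1) order_refl] by simp
  then have "(\<Sum>w\<in>{..<Ma} \<times> {..<Mb}. \<integral>\<^sup>+\<eta>. ennreal (ratio_b w (outp (fst w) (snd w) n \<eta>)) \<partial>noiseM n) =
    (\<Sum>w\<in>{..<Ma} \<times> {..<Mb}. 1)"
    by (intro sum.cong) auto
  then show ?thesis by (simp add: ennreal_of_nat_eq_real_of_nat)
qed

text \<open>\<open>fano_sum\<close> for both ratios, with weights 2 and 1 so that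
  \<open>ln pred\<close> enters only as a difference between the destinations. The 3 adds up the
  Fano remainders, \<open>2 * ln P\<close> comes from the normalisation of \<open>wide\<close>,
  \<open>2 * ln 2\<close> from halving \<open>pred\<close> twice, and 18 from the output
  power.\<close>

lemma broadcast_bound:
  assumes pow: "\<And>j. j < 2 \<Longrightarrow> (\<Sum>t<n. \<Sum>u<Ma. \<Sum>v<Mb. \<integral>\<^sup>+\<eta>. ennreal ((cmod (xt u v t j (outp u v n \<eta>)))\<^sup>2) \<partial>noiseM n)
       \<le> ennreal (P * real n * real Ma * real Mb)"
  shows "2 * ln Ma * (\<Sum>w\<in>{..<Ma} \<times> {..<Mb}. measure (noiseM n) (hit_a w))
      + ln Mb * (\<Sum>w\<in>{..<Ma} \<times> {..<Mb}. measure (noiseM n) (hit_b w))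
    \<le> real Ma * real Mb * (3 + real n * (2 * ln P + 2 * ln 2 + 18))"
proof -
  interpret N: prob_space "noiseM n" by (rule prob_space_noiseM)
  let ?W = "{..<Ma} \<times> {..<Mb}"
  let ?o = "\<lambda>w \<eta>. outp (fst w) (snd w) n \<eta>"
  have X_split: "(\<Sum>w\<in>?W. \<Sum>t<n. \<integral>\<^sup>+\<eta>. ennreal ((cmod (xt (fst w) (snd w) t j (?o w \<eta>)))\<^sup>2) \<partial>noiseM n)
       \<le> ennreal (P * real n * real Ma * real Mb)" if "j < 2" for j
  proof -
    have "(\<Sum>w\<in>?W. \<Sum>t<n. \<integral>\<^sup>+\<eta>. ennreal ((cmod (xt (fst w) (snd w) t j (?o w \<eta>)))\<^sup>2) \<partial>noiseM n) =
      (\<Sum>t<n. \<Sum>w\<in>?W. \<integral>\<^sup>+\<eta>. ennreal ((cmod (xt (fst w) (snd w) t j (?o w \<eta>)))\<^sup>2) \<partial>noiseM n)"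
      by (rule sum.swap)
    also have "\<dots> = (\<Sum>t<n. \<Sum>u<Ma. \<Sum>v<Mb. \<integral>\<^sup>+\<eta>. ennreal ((cmod (xt u v t j (outp u v n \<eta>)))\<^sup>2) \<partial>noiseM n)"
      by (simp add: sum.cartesian_product case_prod_unfold)
    finally show ?thesis using pow[OF that] by simp
  qed
  define Y where "Y w t i \<eta> = (cmod (?o w \<eta> (t, 10 + i)))\<^sup>2" for w t i \<eta>
  \<comment> \<open>The 9 comes from 3 (P + P + 1) <= 9 P, by P >= 1.\<close>
  have Y_sum: "(\<Sum>w\<in>?W. \<Sum>t<n. \<integral>\<^sup>+\<eta>. ennreal (Y w t i \<eta>) \<partial>noiseM n) \<le> ennreal (9 * P * real n * real Ma * real Mb)"
    if "i < 2" for i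
  proof -
    let ?X = "\<lambda>j w t. \<integral>\<^sup>+\<eta>. ennreal ((cmod (xt (fst w) (snd w) t j (?o w \<eta>)))\<^sup>2) \<partial>noiseM n"
    have "(\<Sum>w\<in>?W. \<Sum>t<n. \<integral>\<^sup>+\<eta>. ennreal (Y w t i \<eta>) \<partial>noiseM n) \<le> (\<Sum>w\<in>?W. \<Sum>t<n. 3 * (?X 0 w t + ?X 1 w t + 1))"
      unfolding Y_def using that by (intro sum_mono second_moment_out) auto
    also have "\<dots> = 3 * ((\<Sum>w\<in>?W. \<Sum>t<n. ?X 0 w t) + (\<Sum>w\<in>?W. \<Sum>t<n. ?X 1 w t) + of_nat (Ma * Mb * n))"
      by (simp only: sum.distrib sum_distrib_left[symmetric]) (simp add: card_cartesian_product mult.assoc)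
    also have "\<dots> \<le> 3 * (ennreal (P * real n * real Ma * real Mb) + ennreal (P * real n * real Ma * real Mb) + ennreal (P * real n * real Ma * real Mb))"
    proof (intro mult_left_mono add_mono X_split)
      have "real (Ma * Mb * n) \<le> P * real (Ma * Mb * n)" using mult_right_mono[OF P_ge_1, of "real (Ma * Mb * n)"] by simp
      then have "real (Ma * Mb * n) \<le> P * real n * real Ma * real Mb" by (simp add: mult_ac)
      then show "of_nat (Ma * Mb * n) \<le> ennreal (P * real n * real Ma * real Mb)"
        unfolding ennreal_of_nat_eq_real_of_nat by (rule ennreal_leI)
    qed auto
    also have "\<dots> = ennreal (9 * P * real n * real Ma * real Mb)"
    proof -
      have "3 * (ennreal q + ennreal q + ennreal q) = ennreal (9 * q)" if "0 \<le> q" for q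
      proof -
        have "ennreal (3 * (q + q + q)) = 3 * (ennreal q + ennreal q + ennreal q)"
          using that by (simp only: ennreal_mult ennreal_plus add_nonneg_nonneg ennreal_numeral zero_le_numeral)
        then show ?thesis by (simp add: algebra_simps)
      qed
      from this[of "P * real n * real Ma * real Mb"] show ?thesis using P_ge_1 by (simp only: mult.assoc) simp
    qed
    finally show ?thesis .
  qed
  have om: "?o w \<in> measurable (noiseM n) (noiseM n)" if "w \<in> ?W" for w
    using outp_meas that by auto
  have Y_meas: "Y w t i \<in> borel_measurable (noiseM n)" if "w \<in> ?W" "t < n" "i < 2" for w t i
  proof -
    have "(t, 10 + i) \<in> slots n" using that by auto
    from measurable_compose[OF om[OF that(1)] noiseM_component[OF this]]
    show ?thesis unfolding Y_def by measurable
  qed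
  have Y_int: "integrable (noiseM n) (Y w t i)" if w: "w \<in> ?W" "t < n" "i < 2" for w t i
  proof (rule integrableI_nonneg)
    have "(\<integral>\<^sup>+\<eta>. ennreal (Y w t i \<eta>) \<partial>noiseM n) \<le> (\<Sum>t<n. \<integral>\<^sup>+\<eta>. ennreal (Y w t i \<eta>) \<partial>noiseM n)"
      by (rule member_le_sum) (use w in auto)
    also have "\<dots> \<le> (\<Sum>w\<in>?W. \<Sum>t<n. \<integral>\<^sup>+\<eta>. ennreal (Y w t i \<eta>) \<partial>noiseM n)"
      by (rule member_le_sum[OF w(1)]) auto
    also have "\<dots> < \<infinity>" using Y_sum[OF w(3)] by (simp add: le_less_trans)
    finally show "(\<integral>\<^sup>+\<eta>. ennreal (Y w t i \<eta>) \<partial>noiseM n) < \<infinity>" .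
  qed (use Y_meas[OF w] in \<open>auto simp: Y_def\<close>)
  have Z_int: "integrable (noiseM n) (\<lambda>\<eta>. (cmod (\<eta> (t, 10 + i)))\<^sup>2)" if "t < n" "i < 2" for t i
  proof (rule integrableI_nonneg)
    have c: "(t, 10 + i) \<in> slots n" using that by auto
    show "(\<lambda>\<eta>. (cmod (\<eta> (t, 10 + i)))\<^sup>2) \<in> borel_measurable (noiseM n)"
      using noiseM_component[OF c] by measurable
    show "(\<integral>\<^sup>+\<eta>. ennreal ((cmod (\<eta> (t, 10 + i)))\<^sup>2) \<partial>noiseM n) < \<infinity>"
      using nn_integral_component[OF c] by simp
  qed simp
  have Y_le: "(\<Sum>w\<in>?W. \<Sum>t<n. \<integral>\<eta>. Y w t a \<eta> \<partial>noiseM n) \<le> 9 * P * real n * real Ma * real Mb"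
  proof -
    have nn: "0 \<le> (\<integral>\<eta>. Y w t a \<eta> \<partial>noiseM n)" for w t by (simp add: Y_def)
    have "ennreal (\<Sum>w\<in>?W. \<Sum>t<n. \<integral>\<eta>. Y w t a \<eta> \<partial>noiseM n) = (\<Sum>w\<in>?W. \<Sum>t<n. ennreal (\<integral>\<eta>. Y w t a \<eta> \<partial>noiseM n))"
      using nn by (simp add: sum_nonneg flip: sum_ennreal)
    also have "\<dots> = (\<Sum>w\<in>?W. \<Sum>t<n. \<integral>\<^sup>+\<eta>. ennreal (Y w t a \<eta>) \<partial>noiseM n)"
    proof (intro sum.cong refl nn_integral_eq_integral[symmetric] Y_int ab_simps)
      show "AE \<eta> in noiseM n. 0 \<le> Y w t a \<eta>" for w t by (simp add: Y_def)
    qed auto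
    also have "\<dots> \<le> ennreal (9 * P * real n * real Ma * real Mb)"
      using Y_sum[OF ab_simps(1)] .
    finally show ?thesis using P_ge_1 by (subst (asm) ennreal_le_iff) auto
  qed
  define Q where "Q w t i \<eta> = ln (pred (fst w) t i (?o w \<eta>))" for w t i \<eta>
  have Q_int: "integrable (noiseM n) (Q w t i)" if w: "w \<in> ?W" "t < n" "i < 2" for w t i
  proof (rule Bochner_Integration.integrable_bound)
    show "integrable (noiseM n) (\<lambda>\<eta>. ln 2 + Y w t i \<eta>)" using Y_int[OF w] by simp
    have "fst w < Ma" using w by auto
    from measurable_compose[OF om[OF w(1)] pred_meas[OF this w(2,3)]]
    show "Q w t i \<in> borel_measurable (noiseM n)" unfolding Q_def by measurable
    have "norm (Q w t i \<eta>) \<le> norm (ln 2 + Y w t i \<eta>)" for \<eta>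
      using ln_pred_bounds[of "fst w" t i "?o w \<eta>"] by (simp add: Q_def Y_def)
    then show "AE \<eta> in noiseM n. norm (Q w t i \<eta>) \<le> norm (ln 2 + Y w t i \<eta>)" by simp
  qed
  have ln_ratio_a: "ln (ratio_a w (?o w \<eta>)) = (\<Sum>t<n. Y w t a \<eta> * (1 - 1 / P) - ln P - Q w t a \<eta>)" for w \<eta>
  proof -
    have "ln (ratio_a w (?o w \<eta>)) = (\<Sum>t<n. ln (wide t (?o w \<eta>) / pred (fst w) t a (?o w \<eta>)))"
      unfolding ratio_a_def by (intro ln_prod_pos divide_pos_pos wide_pos pred_pos) auto
    moreover have "ln (wide t (?o w \<eta>)) = Y w t a \<eta> * (1 - 1 / P) - ln P" for t
      using P_ge_1 unfolding wide_def by (subst ln_divide_pos) (auto simp: Y_def)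
    ultimately show ?thesis
      by (simp add: ln_divide_pos[OF wide_pos pred_pos] Q_def)
  qed
  have ln_ratio_b: "ln (ratio_b w (?o w \<eta>)) = (\<Sum>t<n. Q w t a \<eta> + Q w t b \<eta> - 2 * ln 2 - Y w t a \<eta> - Y w t b \<eta>
     + (cmod (\<eta> (t, 10 + a)))\<^sup>2 + (cmod (\<eta> (t, 10 + b)))\<^sup>2)" for w \<eta>
  proof -
    \<comment> \<open>On a true output sample, output minus \<open>mean\<close> is the original
      noise.\<close>
    have lk: "ln (lik (fst w) (snd w) t i (?o w \<eta>)) = Y w t i \<eta> - (cmod (\<eta> (t, 10 + i)))\<^sup>2" if "t < n" "i < 2" for t i
      using outp_eq[OF that, of "fst w" "snd w" \<eta>] by (simp add: lik_def Y_def)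
    have "ln (ratio_b w (?o w \<eta>)) = (\<Sum>t<n. ln (pred (fst w) t a (?o w \<eta>) / 2 * (pred (fst w) t b (?o w \<eta>) / 2)))
       - (\<Sum>t<n. ln (lik (fst w) (snd w) t a (?o w \<eta>) * lik (fst w) (snd w) t b (?o w \<eta>)))"
    proof -
      have "(\<Prod>t<n. pred (fst w) t a (?o w \<eta>) / 2 * (pred (fst w) t b (?o w \<eta>) / 2)) > 0"
        by (intro prod_pos ballI mult_pos_pos divide_pos_pos pred_pos) auto
      then have "ln (ratio_b w (?o w \<eta>)) = ln (\<Prod>t<n. pred (fst w) t a (?o w \<eta>) / 2 * (pred (fst w) t b (?o w \<eta>) / 2))
          - ln (dens (fst w) (snd w) n (?o w \<eta>))"
        unfolding ratio_b_def using dens_pos by (rule ln_divide_pos)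
      moreover have "ln (\<Prod>t<n. pred (fst w) t a (?o w \<eta>) / 2 * (pred (fst w) t b (?o w \<eta>) / 2)) =
        (\<Sum>t<n. ln (pred (fst w) t a (?o w \<eta>) / 2 * (pred (fst w) t b (?o w \<eta>) / 2)))"
        by (intro ln_prod_pos mult_pos_pos divide_pos_pos pred_pos) auto
      moreover have "ln (dens (fst w) (snd w) n (?o w \<eta>)) = (\<Sum>t<n. ln (lik (fst w) (snd w) t a (?o w \<eta>) * lik (fst w) (snd w) t b (?o w \<eta>)))"
        unfolding dens_def by (intro ln_prod_pos mult_pos_pos lik_pos) auto
      ultimately show ?thesis by simp
    qed
    also have "\<dots> = (\<Sum>t<n. ln (pred (fst w) t a (?o w \<eta>) / 2 * (pred (fst w) t b (?o w \<eta>) / 2))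
       - ln (lik (fst w) (snd w) t a (?o w \<eta>) * lik (fst w) (snd w) t b (?o w \<eta>)))"
      by (simp add: sum_subtractf)
    also have "\<dots> = (\<Sum>t<n. Q w t a \<eta> + Q w t b \<eta> - 2 * ln 2 - Y w t a \<eta> - Y w t b \<eta>
     + (cmod (\<eta> (t, 10 + a)))\<^sup>2 + (cmod (\<eta> (t, 10 + b)))\<^sup>2)"
    proof (rule sum.cong[OF refl])
      fix t assume "t \<in> {..<n}"
      then have t: "t < n" by simp
      have "ln (pred (fst w) t a (?o w \<eta>) / 2 * (pred (fst w) t b (?o w \<eta>) / 2)) = Q w t a \<eta> + Q w t b \<eta> - 2 * ln 2"
        using pred_pos by (subst ln_mult_pos) (auto simp: Q_def ln_divide_pos)
      moreover have "ln (lik (fst w) (snd w) t a (?o w \<eta>) * lik (fst w) (snd w) t b (?o w \<eta>)) =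
        Y w t a \<eta> - (cmod (\<eta> (t, 10 + a)))\<^sup>2 + (Y w t b \<eta> - (cmod (\<eta> (t, 10 + b)))\<^sup>2)"
        using lk[OF t] ab_simps by (subst ln_mult_pos[OF lik_pos lik_pos]) auto
      ultimately show "ln (pred (fst w) t a (?o w \<eta>) / 2 * (pred (fst w) t b (?o w \<eta>) / 2))
       - ln (lik (fst w) (snd w) t a (?o w \<eta>) * lik (fst w) (snd w) t b (?o w \<eta>)) =
       Q w t a \<eta> + Q w t b \<eta> - 2 * ln 2 - Y w t a \<eta> - Y w t b \<eta> + (cmod (\<eta> (t, 10 + a)))\<^sup>2 + (cmod (\<eta> (t, 10 + b)))\<^sup>2"
        by simp
    qed
    finally show ?thesis .
  qed
  have int1: "integrable (noiseM n) (\<lambda>\<eta>. ln (ratio_a w (?o w \<eta>)))" if "w \<in> ?W" for w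
    unfolding ln_ratio_a using Y_int[OF that] Q_int[OF that] ab_simps by (intro Bochner_Integration.integrable_sum) auto
  have int2: "integrable (noiseM n) (\<lambda>\<eta>. ln (ratio_b w (?o w \<eta>)))" if "w \<in> ?W" for w
    unfolding ln_ratio_b using Y_int[OF that] Q_int[OF that] Z_int ab_simps
    by (intro Bochner_Integration.integrable_sum Bochner_Integration.integrable_add Bochner_Integration.integrable_diff) auto
  have F1: "(\<Sum>w\<in>?W. \<integral>\<eta>. ln (ratio_a w (?o w \<eta>)) \<partial>noiseM n) \<le> card ?W - ln Ma * (\<Sum>w\<in>?W. N.prob (hit_a w))"
    using Ma_pos hit_sets ratio_a_meas om
    by (intro N.fano_sum hit_a_bound ratio_a_bound int1) (auto simp: ratio_a_pos intro: measurable_compose[OF om])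
  have F2: "(\<Sum>w\<in>?W. \<integral>\<eta>. ln (ratio_b w (?o w \<eta>)) \<partial>noiseM n) \<le> card ?W - ln Mb * (\<Sum>w\<in>?W. N.prob (hit_b w))"
    using Mb_pos hit_sets ratio_b_meas om
    by (intro N.fano_sum hit_b_bound ratio_b_bound int2) (auto simp: ratio_b_pos intro: measurable_compose[OF om])
  have low: "(\<Sum>t<n. - 2 / P * (\<integral>\<eta>. Y w t a \<eta> \<partial>noiseM n) - 2 * ln P - 2 * ln 2) \<le>
     2 * (\<integral>\<eta>. ln (ratio_a w (?o w \<eta>)) \<partial>noiseM n) + (\<integral>\<eta>. ln (ratio_b w (?o w \<eta>)) \<partial>noiseM n)" if w: "w \<in> ?W" for w
  proof -
    have ip: "integrable (noiseM n) (\<lambda>\<eta>. (Y w t a \<eta> - Q w t a \<eta>) - (Y w t b \<eta> - Q w t b \<eta>))" if "t < n" for t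
      using Y_int[OF w that] Q_int[OF w that] ab_simps by auto
    have sw: "(\<integral>\<eta>. (Y w t a \<eta> - Q w t a \<eta>) - (Y w t b \<eta> - Q w t b \<eta>) \<partial>noiseM n) = 0" if "t < n" for t
    proof -
      have "fst w < Ma" "snd w < Mb" using w by auto
      from integral_swap_ab[OF this that]
      have "(\<integral>\<eta>. Y w t a \<eta> - Q w t a \<eta> \<partial>noiseM n) = (\<integral>\<eta>. Y w t b \<eta> - Q w t b \<eta> \<partial>noiseM n)"
        unfolding Y_def Q_def .
      then show ?thesis
        using Y_int[OF w that] Q_int[OF w that] ab_simps by (subst Bochner_Integration.integral_diff) auto
    qed
    have "(\<Sum>t<n. - 2 / P * (\<integral>\<eta>. Y w t a \<eta> \<partial>noiseM n) - 2 * ln P - 2 * ln 2) =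
      (\<Sum>t<n. \<integral>\<eta>. - 2 / P * Y w t a \<eta> - 2 * ln P - 2 * ln 2 + ((Y w t a \<eta> - Q w t a \<eta>) - (Y w t b \<eta> - Q w t b \<eta>)) \<partial>noiseM n)"
    proof (rule sum.cong[OF refl])
      fix t assume "t \<in> {..<n}"
      then have t: "t < n" by simp
      have iY: "integrable (noiseM n) (\<lambda>\<eta>. - 2 / P * Y w t a \<eta>)" using Y_int[OF w t ab_simps(1)] by auto
      show "- 2 / P * (\<integral>\<eta>. Y w t a \<eta> \<partial>noiseM n) - 2 * ln P - 2 * ln 2 =
        (\<integral>\<eta>. - 2 / P * Y w t a \<eta> - 2 * ln P - 2 * ln 2 + ((Y w t a \<eta> - Q w t a \<eta>) - (Y w t b \<eta> - Q w t b \<eta>)) \<partial>noiseM n)"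
        using iY by (subst Bochner_Integration.integral_add[OF _ ip[OF t]]) (auto simp: sw[OF t] N.prob_space)
    qed
    also have "\<dots> = (\<integral>\<eta>. (\<Sum>t<n. - 2 / P * Y w t a \<eta> - 2 * ln P - 2 * ln 2 + ((Y w t a \<eta> - Q w t a \<eta>) - (Y w t b \<eta> - Q w t b \<eta>))) \<partial>noiseM n)"
      using Y_int[OF w] Q_int[OF w] ab_simps
      by (intro Bochner_Integration.integral_sum[symmetric] Bochner_Integration.integrable_add Bochner_Integration.integrable_diff) auto
    also have "\<dots> \<le> (\<integral>\<eta>. 2 * ln (ratio_a w (?o w \<eta>)) + ln (ratio_b w (?o w \<eta>)) \<partial>noiseM n)"
    proof (rule integral_mono)
      show "integrable (noiseM n) (\<lambda>\<eta>. \<Sum>t<n. - 2 / P * Y w t a \<eta> - 2 * ln P - 2 * ln 2 + ((Y w t a \<eta> - Q w t a \<eta>) - (Y w t b \<eta> - Q w t b \<eta>)))"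
        using Y_int[OF w] Q_int[OF w] ab_simps
        by (intro Bochner_Integration.integrable_sum Bochner_Integration.integrable_add Bochner_Integration.integrable_diff) auto
      show "integrable (noiseM n) (\<lambda>\<eta>. 2 * ln (ratio_a w (?o w \<eta>)) + ln (ratio_b w (?o w \<eta>)))"
        using int1[OF w] int2[OF w] by auto
      \<comment> \<open>The terms in \<open>Y\<close> and \<open>Q\<close> agree on both sides; only
        the squared noises on the right are dropped, being nonnegative.\<close>
      show "(\<Sum>t<n. - 2 / P * Y w t a \<eta> - 2 * ln P - 2 * ln 2 + ((Y w t a \<eta> - Q w t a \<eta>) - (Y w t b \<eta> - Q w t b \<eta>)))
         \<le> 2 * ln (ratio_a w (?o w \<eta>)) + ln (ratio_b w (?o w \<eta>))" for \<eta>
        unfolding ln_ratio_a ln_ratio_b sum_distrib_left sum.distrib[symmetric]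
        by (rule sum_mono) (simp add: algebra_simps)
    qed
    also have "\<dots> = 2 * (\<integral>\<eta>. ln (ratio_a w (?o w \<eta>)) \<partial>noiseM n) + (\<integral>\<eta>. ln (ratio_b w (?o w \<eta>)) \<partial>noiseM n)"
      using int1[OF w] int2[OF w] by simp
    finally show ?thesis .
  qed
  \<comment> \<open>The exponent of \<open>wide\<close> costs 2/P times the output power, which is
    at most 9 P on average over slots and messages.\<close>
  have "- 18 * (real n * real Ma * real Mb) - (2 * ln P + 2 * ln 2) * (real n * real Ma * real Mb) \<le>
    - 2 / P * (\<Sum>w\<in>?W. \<Sum>t<n. \<integral>\<eta>. Y w t a \<eta> \<partial>noiseM n) - (2 * ln P + 2 * ln 2) * (real n * real Ma * real Mb)"
  proof -
    have "2 / P * (\<Sum>w\<in>?W. \<Sum>t<n. \<integral>\<eta>. Y w t a \<eta> \<partial>noiseM n) \<le> 2 / P * (9 * P * real n * real Ma * real Mb)"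
      using P_ge_1 by (intro mult_left_mono Y_le) auto
    also have "\<dots> = 18 * (real n * real Ma * real Mb)" using P_ge_1 by simp
    finally show ?thesis by simp
  qed
  also have "\<dots> = (\<Sum>w\<in>?W. \<Sum>t<n. - 2 / P * (\<integral>\<eta>. Y w t a \<eta> \<partial>noiseM n) - 2 * ln P - 2 * ln 2)"
    by (simp add: sum_subtractf card_cartesian_product sum_distrib_left sum_divide_distrib sum_negf algebra_simps)
  also have "\<dots> \<le> (\<Sum>w\<in>?W. 2 * (\<integral>\<eta>. ln (ratio_a w (?o w \<eta>)) \<partial>noiseM n) + (\<integral>\<eta>. ln (ratio_b w (?o w \<eta>)) \<partial>noiseM n))"
    by (rule sum_mono) (rule low)
  also have "\<dots> = 2 * (\<Sum>w\<in>?W. \<integral>\<eta>. ln (ratio_a w (?o w \<eta>)) \<partial>noiseM n) + (\<Sum>w\<in>?W. \<integral>\<eta>. ln (ratio_b w (?o w \<eta>)) \<partial>noiseM n)"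
    by (simp add: sum.distrib sum_distrib_left)
  also have "\<dots> \<le> 2 * (card ?W - ln Ma * (\<Sum>w\<in>?W. N.prob (hit_a w))) + (card ?W - ln Mb * (\<Sum>w\<in>?W. N.prob (hit_b w)))"
    by (intro add_mono mult_left_mono F1 F2) auto
  finally show ?thesis
    by (simp add: card_cartesian_product algebra_simps)
qed

end

section \<open>Reduction of codes to the second hop\<close>

lemma past_cong: "(\<And>s. s < t \<Longrightarrow> f s = g s) \<Longrightarrow> past f t = past g t"
  unfolding past_def by (intro arg_cong[where f=concat] map_cong) auto

lemma src_view_cong:
  assumes "\<And>s k. s < t \<Longrightarrow> \<eta> (s, k) = \<eta>' (s, k)"
  shows "src_view m i \<eta> hs t = src_view m i \<eta>' hs t"
  using assms by (cases m) (auto simp: src_view_def chH_def chG_def yR_def yD_def Hc_def Gc_def ZR_def ZD_def intro!: past_cong)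

text \<open>In all four models nothing reaches a relay without delay except the first-hop
  coefficients, the indices below 4. Together with \<open>src_view_cong\<close> this is the only
  place where the feedback model matters.\<close>

lemma rel_view_cong:
  assumes "\<And>s k. s < t \<Longrightarrow> \<eta> (s, k) = \<eta>' (s, k)" "\<And>k. k < 4 \<Longrightarrow> \<eta> (t, k) = \<eta>' (t, k)"
  shows "rel_view m i \<eta> hs t = rel_view m i \<eta>' hs t"
proof -
  have H: "past (chH \<eta>) (Suc t) = past (chH \<eta>') (Suc t)"
    using assms by (intro past_cong) (auto simp: chH_def Hc_def less_Suc_eq)
  have G: "chG \<eta> s = chG \<eta>' s" "yR \<eta> x s k = yR \<eta>' x s k" "yD \<eta> x s k = yD \<eta>' x s k" if "s < t" for s x k
    using assms(1)[OF that] by (auto simp: chG_def yR_def yD_def Hc_def Gc_def ZR_def ZD_def)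
  have "past (\<lambda>s. [yR \<eta> (hs ! s) s i]) t = past (\<lambda>s. [yR \<eta>' (hs ! s) s i]) t"
    "past (\<lambda>s. [yD \<eta> (hs ! s) s i]) t = past (\<lambda>s. [yD \<eta>' (hs ! s) s i]) t"
    "past (\<lambda>s. chG \<eta> s @ [yD \<eta> (hs ! s) s i]) t = past (\<lambda>s. chG \<eta>' s @ [yD \<eta>' (hs ! s) s i]) t"
    "past (\<lambda>s. chG \<eta> s @ [yD \<eta> (hs ! s) s 0, yD \<eta> (hs ! s) s 1]) t = past (\<lambda>s. chG \<eta>' s @ [yD \<eta>' (hs ! s) s 0, yD \<eta>' (hs ! s) s 1]) t"
    by (intro past_cong, simp only: G)+
  then show ?thesis unfolding rel_view_def by (cases m) (simp_all only: H fb_model.case)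
qed

text \<open>A history of length \<open>t\<close> ends with slot \<open>t - 1\<close>, of which only
  the first-hop coefficients are read; hence the \<open>Suc s\<close>.\<close>

lemma hist_cong:
  assumes "\<And>s k. Suc s < t \<or> Suc s = t \<and> k < 4 \<Longrightarrow> \<eta> (s, k) = \<eta>' (s, k)"
  shows "hist c m w \<eta> t = hist c m w \<eta>' t"
  using assms
proof (induction t)
  case (Suc t)
  have IH: "hist c m w \<eta> t = hist c m w \<eta>' t"
    by (rule Suc.IH) (use Suc.prems in auto)
  have e: "src_view m i \<eta> hs t = src_view m i \<eta>' hs t" "rel_view m i \<eta> hs t = rel_view m i \<eta>' hs t" for i hs
    by (intro src_view_cong rel_view_cong; use Suc.prems in auto)+
  have "step c m w \<eta> t hs = step c m w \<eta>' t hs" for hs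
    unfolding step_def by (intro ext if_cong refl arg_cong[OF e(1)] arg_cong[OF e(2)])
  then show ?case by (simp add: IH)
qed simp

lemma Xsig_upd:
  assumes "t < s \<or> s = t \<and> 4 \<le> k"
  shows "Xsig c m w (\<eta>((s, k) := z)) t = Xsig c m w \<eta> t"
  unfolding Xsig_def using assms by (subst hist_cong[of "Suc t" _ \<eta>]) auto

section \<open>Inverting the second hop\<close>

text \<open>The counterpart of \<open>mean\<close> on noise samples.\<close>

definition clean_out :: "code \<Rightarrow> fb_model \<Rightarrow> (nat \<Rightarrow> nat) \<Rightarrow> nat \<Rightarrow> nat \<Rightarrow> (nat \<times> nat \<Rightarrow> complex) \<Rightarrow> complex" where
  "clean_out c m w t i \<eta> = Gc \<eta> t i 0 * Xsig c m w \<eta> t 2 + Gc \<eta> t i 1 * Xsig c m w \<eta> t 3"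

definition unshift :: "code \<Rightarrow> fb_model \<Rightarrow> (nat \<Rightarrow> nat) \<Rightarrow> nat \<Rightarrow> (nat \<times> nat \<Rightarrow> complex) \<Rightarrow> nat \<times> nat \<Rightarrow> complex" where
  "unshift c m w t \<eta> = \<eta>((t, 10) := \<eta> (t, 10) - clean_out c m w t 0 \<eta>, (t, 11) := \<eta> (t, 11) - clean_out c m w t 1 \<eta>)"

text \<open>Recovers the noise sample from the output sample.\<close>

primrec undo :: "code \<Rightarrow> fb_model \<Rightarrow> (nat \<Rightarrow> nat) \<Rightarrow> nat \<Rightarrow> (nat \<times> nat \<Rightarrow> complex) \<Rightarrow> nat \<times> nat \<Rightarrow> complex" where
  "undo c m w 0 \<eta> = \<eta>"
| "undo c m w (Suc t) \<eta> = unshift c m w t (undo c m w t \<eta>)"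

lemma clean_out_upd:
  assumes "i < 2" "t < s \<or> s = t \<and> 8 \<le> k"
  shows "clean_out c m w t i (\<eta>((s, k) := z)) = clean_out c m w t i \<eta>"
proof -
  have "Xsig c m w (\<eta>((s, k) := z)) t = Xsig c m w \<eta> t"
    using assms by (intro Xsig_upd) auto
  then show ?thesis using assms by (auto simp: clean_out_def Gc_def)
qed

lemma unshift_upd: "t < s \<Longrightarrow> unshift c m w t (\<eta>((s, k) := z)) = (unshift c m w t \<eta>)((s, k) := z)"
  by (auto simp: unshift_def clean_out_upd fun_eq_iff)

lemma undo_upd: "t \<le> s \<Longrightarrow> undo c m w t (\<eta>((s, k) := z)) = (undo c m w t \<eta>)((s, k) := z)"
  by (induction t) (auto simp: unshift_upd)

lemma undo_future: "t \<le> s \<Longrightarrow> undo c m w t \<eta> (s, k) = \<eta> (s, k)"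
  by (induction t) (auto simp: unshift_def)

lemma undo_inputs: "k < 10 \<Longrightarrow> undo c m w t \<eta> (s, k) = \<eta> (s, k)"
  by (induction t) (auto simp: unshift_def)

lemma undo_later:
  assumes "\<And>s k z \<eta>. t \<le> s \<Longrightarrow> 10 \<le> k \<Longrightarrow> F (\<eta>((s, k) := z)) = F \<eta>" and "t \<le> l"
  shows "F (undo c m w l \<eta>) = F (undo c m w t \<eta>)"
  using assms(2)
proof (induction rule: dec_induct)
  case (step l)
  have "F (undo c m w (Suc l) \<eta>) = F (undo c m w l \<eta>)"
    unfolding undo.simps unshift_def using step by (subst assms(1), simp, simp, subst assms(1)) simp_all
  with step show ?case by simp
qed simp

lemma Xsig_undo: "t \<le> l \<Longrightarrow> Xsig c m w (undo c m w l \<eta>) t = Xsig c m w (undo c m w t \<eta>) t"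
  by (rule undo_later) (auto simp del: fun_upd_apply intro!: Xsig_upd)

lemma clean_out_undo: "t \<le> l \<Longrightarrow> i < 2 \<Longrightarrow> clean_out c m w t i (undo c m w l \<eta>) = clean_out c m w t i (undo c m w t \<eta>)"
  by (rule undo_later) (auto simp del: fun_upd_apply intro!: clean_out_upd)

text \<open>The channel adds back what \<open>undo\<close> subtracted in slot \<open>s\<close>, and
  later steps of \<open>undo\<close> do not touch that slot.\<close>

lemma yD_undo:
  assumes "s < l" "i < 2"
  shows "yD (undo c m w l \<eta>) (Xsig c m w (undo c m w l \<eta>) s) s i = \<eta> (s, 10 + i)"
proof -
  have "undo c m w l \<eta> (s, 10 + i) = undo c m w (Suc s) \<eta> (s, 10 + i)"
    by (rule undo_later) (use assms in auto)
  also have "\<dots> = \<eta> (s, 10 + i) - clean_out c m w s i (undo c m w l \<eta>)"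
    unfolding clean_out_undo[OF less_imp_le[OF assms(1)] assms(2)]
    using assms(2) by (auto simp: unshift_def undo_future less_2_cases_iff)
  finally show ?thesis by (simp add: yD_def ZD_def clean_out_def)
qed

text \<open>The view of a destination written on output samples. Neither code nor messages occur in
  it, so decoding becomes one fixed function of the output sample.\<close>

definition out_view :: "nat \<Rightarrow> nat \<Rightarrow> (nat \<times> nat \<Rightarrow> complex) \<Rightarrow> complex list" where
  "out_view n i \<eta> = past (\<lambda>s. [\<eta> (s, 10 + i)]) n @ past (\<lambda>s. chH \<eta> s @ chG \<eta> s) n"

lemma dest_view_undo: "i < 2 \<Longrightarrow> dest_view c m w (undo c m w n \<eta>) n i = out_view n i \<eta>"
  unfolding dest_view_def out_view_def
  by (intro arg_cong2[where f="(@)"] past_cong) (auto simp: yD_undo chH_def chG_def Hc_def Gc_def undo_inputs)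

lemma out_view_upd:
  "i < 2 \<Longrightarrow> k \<ge> 10 \<Longrightarrow> k \<noteq> 10 + i \<Longrightarrow> out_view n i (\<eta>((s, k) := z)) = out_view n i \<eta>"
  unfolding out_view_def by (auto simp: chH_def chG_def Hc_def Gc_def)

lemma undo_meas:
  assumes "\<And>t k. t < n \<Longrightarrow> k < 4 \<Longrightarrow> (\<lambda>\<eta>. Xsig c m w \<eta> t k) \<in> borel_measurable (noiseM n)"
  shows "t \<le> n \<Longrightarrow> undo c m w t \<in> measurable (noiseM n) (noiseM n)"
proof (induction t)
  case 0 then show ?case by (simp add: measurable_ident_sets)
next
  case (Suc t)
  then have t: "t < n" by simp
  have [measurable]: "(\<lambda>\<eta>. Xsig c m w \<eta> t 2) \<in> borel_measurable (noiseM n)" "(\<lambda>\<eta>. Xsig c m w \<eta> t 3) \<in> borel_measurable (noiseM n)"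
    using assms[OF t] by auto
  have cl: "clean_out c m w t i \<in> borel_measurable (noiseM n)" if "i < 2" for i
  proof -
    have "(t, 4 + 2 * i + 0) \<in> slots n" "(t, 4 + 2 * i + 1) \<in> slots n" using t that by auto
    then show ?thesis
      unfolding clean_out_def Gc_def by (intro borel_measurable_add borel_measurable_times noiseM_component) measurable
  qed
  have "unshift c m w t \<in> measurable (noiseM n) (noiseM n)"
    unfolding unshift_def using t
    by (intro noiseM_update borel_measurable_diff cl noiseM_component) auto
  then show ?case using Suc t measurable_compose[of "undo c m w t"] by (simp add: less_imp_le)
qed

section \<open>The bound for a single code\<close>

text \<open>Gives \<open>u\<close> to destination \<open>a\<close> and \<open>v\<close> to
  \<open>b\<close> in either order of the destinations, so that both cases are treated at
  once.\<close>

definition msg_pair :: "nat \<Rightarrow> nat \<Rightarrow> nat \<Rightarrow> nat \<Rightarrow> nat" where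
  "msg_pair a u v = (\<lambda>k. if k = 0 then (if a = 0 then u else v) else (if a = 0 then v else u))"

lemma sum_msgs:
  assumes ab: "a = 0 \<and> b = 1 \<or> a = 1 \<and> b = 0"
  shows "(\<Sum>w\<in>msgs c. g w) = (\<Sum>p\<in>{..<msz c a} \<times> {..<msz c b}. g (msg_pair a (fst p) (snd p)))"
proof (rule sum.reindex_cong)
  show "inj_on (\<lambda>p. msg_pair a (fst p) (snd p)) ({..<msz c a} \<times> {..<msz c b})"
  proof (rule inj_onI)
    fix p q assume "msg_pair a (fst p) (snd p) = msg_pair a (fst q) (snd q)"
    from fun_cong[OF this, of 0] fun_cong[OF this, of 1] ab show "p = q"
      by (auto simp: msg_pair_def prod_eq_iff)
  qed
  show "msgs c = (\<lambda>p. msg_pair a (fst p) (snd p)) ` ({..<msz c a} \<times> {..<msz c b})"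
    using ab by (auto simp: msgs_def msg_pair_def image_iff Bex_def fun_eq_iff; metis)
qed simp

lemma msg_pair_msgs:
  assumes ab: "a = 0 \<and> b = 1 \<or> a = 1 \<and> b = 0" and "u < msz c a" "v < msz c b"
  shows "msg_pair a u v \<in> msgs c"
  using assms by (auto simp: msgs_def msg_pair_def image_iff)

text \<open>For fixed messages the noise sample, hence every relay signal, is a function of the
  output sample; this makes the code an instance of \<open>relay_broadcast\<close>. The factors
  \<open>1 - err\<close> are average success probabilities.\<close>

lemma code_bound:
  assumes ab: "a = 0 \<and> b = 1 \<or> a = 1 \<and> b = 0" and valid: "valid_code m P n c" and P: "P \<ge> 1"
  shows "2 * ln (msz c a) * (1 - err m n c a) + ln (msz c b) * (1 - err m n c b) \<le> 3 + real n * (2 * ln P + 2 * ln 2 + 18)"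
proof -
  interpret N: prob_space "noiseM n" by (rule prob_space_noiseM)
  let ?w = "msg_pair a"
  \<comment> \<open>Relay \<open>j\<close> has signal index \<open>2 + j\<close>. Undoing the slots
    before \<open>t\<close> suffices, since its signal reads no later noise.\<close>
  define xt where "xt u v t j \<eta> = Xsig c m (?w u v) (undo c m (?w u v) t \<eta>) t (2 + j)" for u v t j \<eta>
  define \<delta> where "\<delta> i \<eta> = dec c i (out_view n i \<eta>)" for i \<eta>
  have ab2: "a < 2" "b < 2" "a \<noteq> b" using ab by auto
  have pos: "msz c a > 0" "msz c b > 0" using valid ab by (auto simp: valid_code_def)
  have wa: "?w u v a = u" "?w u v b = v" for u v using ab by (auto simp: msg_pair_def)
  have Xm: "(\<lambda>\<eta>. Xsig c m (?w u v) \<eta> t k) \<in> borel_measurable (noiseM n)" if "u < msz c a" "v < msz c b" "t < n" "k < 4" for u v t k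
    using valid that msg_pair_msgs[OF ab that(1,2)] by (auto simp: valid_code_def)
  have um: "undo c m (?w u v) t \<in> measurable (noiseM n) (noiseM n)" if "u < msz c a" "v < msz c b" "t \<le> n" for u v t
    using that Xm by (intro undo_meas) auto
  have dm: "{\<eta> \<in> space (noiseM n). dec c i (dest_view c m (?w u v) \<eta> n i) = ?w u v i} \<in> sets (noiseM n)" if "u < msz c a" "v < msz c b" "i < 2" for u v i
    using valid that msg_pair_msgs[OF ab that(1,2)] by (auto simp: valid_code_def)
  have dm': "{\<eta> \<in> space (noiseM n). \<delta> i \<eta> = ?w u v i} \<in> sets (noiseM n)" if "u < msz c a" "v < msz c b" "i < 2" for u v i
  proof -
    have "{\<eta> \<in> space (noiseM n). \<delta> i \<eta> = ?w u v i} =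
      undo c m (?w u v) n -` {\<eta> \<in> space (noiseM n). dec c i (dest_view c m (?w u v) \<eta> n i) = ?w u v i} \<inter> space (noiseM n)"
      using measurable_space[OF um[OF that(1,2) order_refl]] dest_view_undo[OF that(3)] by (auto simp: \<delta>_def)
    then show ?thesis using measurable_sets[OF um[OF that(1,2) order_refl] dm[OF that]] by simp
  qed
  interpret R: relay_broadcast n a b "msz c a" "msz c b" P xt "\<delta> a" "\<delta> b"
  proof
    show "a = 0 \<and> b = 1 \<or> a = 1 \<and> b = 0" by (rule ab)
    show "0 < msz c a" "0 < msz c b" "1 \<le> P" by (fact pos P)+
    show "xt u v t j (\<eta>((s, k) := z)) = xt u v t j \<eta>" if "t < s \<or> s = t \<and> 4 \<le> k" for u v t j \<eta> s k z
      unfolding xt_def using that by (subst undo_upd) (auto simp: Xsig_upd simp del: fun_upd_apply)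
    show "xt u v t j \<in> borel_measurable (noiseM n)" if "u < msz c a" "v < msz c b" "t < n" "j < 2" for u v t j
      unfolding xt_def using that by (intro measurable_compose[OF um Xm]) auto
    show "{\<eta> \<in> space (noiseM n). \<delta> a \<eta> = u} \<in> sets (noiseM n)" if "u < msz c a" for u
      using dm'[OF that pos(2) ab2(1)] by (simp add: wa)
    show "{\<eta> \<in> space (noiseM n). \<delta> b \<eta> = v} \<in> sets (noiseM n)" if "v < msz c b" for v
      using dm'[OF pos(1) that ab2(2)] by (simp add: wa)
    show "\<delta> a (\<eta>((s, 10 + b) := z)) = \<delta> a \<eta>" for \<eta> s z
      unfolding \<delta>_def using ab2 by (subst out_view_upd) auto
  qed
  \<comment> \<open>\<open>undo\<close> inverts \<open>outp\<close>, so signals and views evaluated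
    at \<open>outp\<close> are those of the code on the actual noise.\<close>
  have undo_outp: "undo c m (?w u v) t (R.outp u v t \<eta>) = \<eta>" for u v t \<eta>
  proof (induction t)
    case (Suc t)
    let ?o = "R.outp u v t \<eta>"
    have mean: "R.mean u v t i ?o = clean_out c m (?w u v) t i \<eta>" if "i < 2" for i
      using that by (simp add: R.mean_def clean_out_def xt_def Suc.IH Gc_def R.outp_inputs)
    define e where "e = \<eta>((t, 10 + a) := \<eta> (t, 10 + a) + clean_out c m (?w u v) t a \<eta>, (t, 10 + b) := \<eta> (t, 10 + b) + clean_out c m (?w u v) t b \<eta>)"
    have 1: "undo c m (?w u v) t (R.outp u v (Suc t) \<eta>) = e"
      using ab2 by (simp add: R.shift_def undo_upd Suc.IH mean R.outp_future e_def)
    have 2: "unshift c m (?w u v) t e = \<eta>"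
      unfolding unshift_def e_def using ab2 ab by (auto simp: clean_out_upd fun_eq_iff)
    show ?case unfolding undo.simps 1 2 ..
  qed simp
  have xt_eq: "xt u v t j (R.outp u v n \<eta>) = Xsig c m (?w u v) \<eta> t (2 + j)" if "t < n" for u v t j \<eta>
    using Xsig_undo[OF less_imp_le[OF that], of c m "?w u v" "R.outp u v n \<eta>"] by (simp add: xt_def undo_outp)
  have view_eq: "\<delta> i (R.outp u v n \<eta>) = dec c i (dest_view c m (?w u v) \<eta> n i)" if "i < 2" for u v i \<eta>
    using dest_view_undo[OF that, of c m "?w u v" n "R.outp u v n \<eta>"] by (simp add: \<delta>_def undo_outp)
  have MM: "real (msz c 0) * real (msz c 1) = real (msz c a) * real (msz c b)" using ab by auto
  let ?W = "{..<msz c a} \<times> {..<msz c b}"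
  have "(\<Sum>t<n. \<Sum>u<msz c a. \<Sum>v<msz c b. \<integral>\<^sup>+\<eta>. ennreal ((cmod (xt u v t j (R.outp u v n \<eta>)))\<^sup>2) \<partial>noiseM n)
       \<le> ennreal (P * real n * real (msz c a) * real (msz c b))" if "j < 2" for j
  proof -
    have "(\<Sum>t<n. \<Sum>u<msz c a. \<Sum>v<msz c b. \<integral>\<^sup>+\<eta>. ennreal ((cmod (xt u v t j (R.outp u v n \<eta>)))\<^sup>2) \<partial>noiseM n)
      = (\<Sum>t<n. \<Sum>w\<in>msgs c. \<integral>\<^sup>+\<eta>. ennreal ((cmod (Xsig c m w \<eta> t (2 + j)))\<^sup>2) \<partial>noiseM n)"
      unfolding sum_msgs[OF ab] by (simp add: xt_eq sum.cartesian_product case_prod_unfold)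
    also have "\<dots> \<le> ennreal (P * real n * real (msz c 0) * real (msz c 1))"
      using valid that by (simp add: valid_code_def)
    finally show ?thesis using MM by (simp add: mult.assoc)
  qed
  note main = R.broadcast_bound[OF this]
  have err: "1 - err m n c i = (\<Sum>p\<in>?W. N.prob {\<eta> \<in> space (noiseM n). dec c i (dest_view c m (?w (fst p) (snd p)) \<eta> n i) = ?w (fst p) (snd p) i})
      / (real (msz c a) * real (msz c b))" if "i < 2" for i
  proof -
    have "N.prob {\<eta> \<in> space (noiseM n). dec c i (dest_view c m (?w (fst p) (snd p)) \<eta> n i) \<noteq> ?w (fst p) (snd p) i}
      = 1 - N.prob {\<eta> \<in> space (noiseM n). dec c i (dest_view c m (?w (fst p) (snd p)) \<eta> n i) = ?w (fst p) (snd p) i}" if "p \<in> ?W" for p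
      using dm[of "fst p" "snd p" i] that \<open>i < 2\<close> by (subst N.prob_neg) auto
    then have "err m n c i = (\<Sum>p\<in>?W. 1 - N.prob {\<eta> \<in> space (noiseM n). dec c i (dest_view c m (?w (fst p) (snd p)) \<eta> n i) = ?w (fst p) (snd p) i})
      / (real (msz c a) * real (msz c b))"
      unfolding err_def sum_msgs[OF ab] MM by simp
    then show ?thesis using pos by (simp add: sum_subtractf card_cartesian_product field_simps)
  qed
  have ha: "(\<Sum>p\<in>?W. N.prob (R.hit_a p)) = real (msz c a) * real (msz c b) * (1 - err m n c a)"
    unfolding err[OF ab2(1)] using pos by (simp add: R.hit_a_def view_eq[OF ab2(1)] wa)
  have hb: "(\<Sum>p\<in>?W. N.prob (R.hit_b p)) = real (msz c a) * real (msz c b) * (1 - err m n c b)"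
    unfolding err[OF ab2(2)] using pos by (simp add: R.hit_b_def view_eq[OF ab2(2)] wa)
  have "real (msz c a) * real (msz c b) * (2 * ln (msz c a) * (1 - err m n c a) + ln (msz c b) * (1 - err m n c b))
    \<le> real (msz c a) * real (msz c b) * (3 + real n * (2 * ln P + 2 * ln 2 + 18))"
    using main unfolding ha hb by (simp add: algebra_simps)
  then show ?thesis using pos by (subst (asm) mult_le_cancel_left_pos) auto
qed

section \<open>From codes to degrees of freedom\<close>

text \<open>Each destination takes the role of \<open>a\<close> once. A single blocklength suffices,
  because \<open>code_bound\<close> holds for every \<open>n\<close>.\<close>

lemma achievable_bound:
  assumes ach: "achievable m P r1 r2" and P: "P \<ge> 1"
  shows "(2 * r1 + r2) * ln 2 \<le> 2 * ln P + 2 * ln 2 + 19" "(r1 + 2 * r2) * ln 2 \<le> 2 * ln P + 2 * ln 2 + 19"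
proof -
  have r: "r1 \<ge> 0" "r2 \<ge> 0" using ach by (auto simp: achievable_def)
  \<comment> \<open>\<open>z\<close> is a guaranteed success probability; as it ranges over (0,1) it
    drops out at the end.\<close>
  have "z * ((2 * r1 + r2) * ln 2) \<le> 2 * ln P + 2 * ln 2 + 19 \<and> z * ((r1 + 2 * r2) * ln 2) \<le> 2 * ln P + 2 * ln 2 + 19"
    if z: "0 < z" "z < 1" for z :: real
  proof -
    from ach z obtain N where N: "\<And>n. n \<ge> N \<Longrightarrow> \<exists>c. valid_code m P n c \<and>
        real (msz c 0) \<ge> 2 powr (real n * r1) \<and> real (msz c 1) \<ge> 2 powr (real n * r2) \<and>
        err m n c 0 \<le> 1 - z \<and> err m n c 1 \<le> 1 - z"
      unfolding achievable_def by (metis diff_gt_0_iff_gt)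
    \<comment> \<open>With n >= 3 the additive 3 is at most \<open>n\<close>, which turns 18 into
      19.\<close>
    define n where "n = max N 3"
    obtain c where c: "valid_code m P n c" "real (msz c 0) \<ge> 2 powr (real n * r1)" "real (msz c 1) \<ge> 2 powr (real n * r2)"
        "err m n c 0 \<le> 1 - z" "err m n c 1 \<le> 1 - z"
      using N[of n] by (auto simp: n_def)
    have n3: "real n \<ge> 3" by (simp add: n_def)
    have ln_ge: "real n * r * ln 2 \<le> ln (real M)" if "real M \<ge> 2 powr (real n * r)" for M r
    proof -
      have "ln (2 powr (real n * r)) \<le> ln (real M)" using that by (intro ln_mono) auto
      then show ?thesis by simp
    qed
    have part: "z * (real n * r * ln 2) \<le> ln (real (msz c i)) * (1 - err m n c i)"
      if "real (msz c i) \<ge> 2 powr (real n * r)" "err m n c i \<le> 1 - z" "r \<ge> 0" for i r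
    proof -
      have "(real n * r * ln 2) * z \<le> ln (real (msz c i)) * (1 - err m n c i)"
        using ln_ge[OF that(1)] that z by (intro mult_mono) (auto intro: order_trans[of 0 "real n * r * ln 2"])
      then show ?thesis by (simp add: mult.commute)
    qed
    have p0: "z * (real n * r1 * ln 2) \<le> ln (real (msz c 0)) * (1 - err m n c 0)"
      and p1: "z * (real n * r2 * ln 2) \<le> ln (real (msz c 1)) * (1 - err m n c 1)"
      using part c r by auto
    have "2 * ln (msz c 0) * (1 - err m n c 0) + ln (msz c 1) * (1 - err m n c 1) \<le> 3 + real n * (2 * ln P + 2 * ln 2 + 18)"
      by (rule code_bound[OF _ c(1) P]) simp
    with p0 p1 n3 have "real n * (z * ((2 * r1 + r2) * ln 2)) \<le> real n * (2 * ln P + 2 * ln 2 + 19)"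
      by (simp add: algebra_simps)
    moreover have "2 * ln (msz c 1) * (1 - err m n c 1) + ln (msz c 0) * (1 - err m n c 0) \<le> 3 + real n * (2 * ln P + 2 * ln 2 + 18)"
      by (rule code_bound[OF _ c(1) P]) simp
    with p0 p1 n3 have "real n * (z * ((r1 + 2 * r2) * ln 2)) \<le> real n * (2 * ln P + 2 * ln 2 + 19)"
      by (simp add: algebra_simps)
    ultimately show ?thesis using n3 by (auto simp: mult_le_cancel_left)
  qed
  then show "(2 * r1 + r2) * ln 2 \<le> 2 * ln P + 2 * ln 2 + 19" "(r1 + 2 * r2) * ln 2 \<le> 2 * ln P + 2 * ln 2 + 19"
    by (auto intro: field_le_mult_one_interval)
qed

text \<open>The two rate inequalities add up to three times the sum rate, against twice
  \<open>2 * ln P\<close>; this is the 4/3.\<close>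

lemma C_sum_bound:
  assumes P: "P \<ge> 1"
  shows "C_sum m P \<le> ereal (4 / 3 * log 2 P + (4 * ln 2 + 38) / (3 * ln 2))"
  unfolding C_sum_def
proof (rule Sup_least, clarify)
  fix r1 r2 assume "achievable m P r1 r2"
  from achievable_bound[OF this P] have "3 * ln 2 * (r1 + r2) \<le> 4 * ln P + 4 * ln 2 + 38"
    by (simp add: algebra_simps)
  then have "r1 + r2 \<le> 4 / 3 * log 2 P + (4 * ln 2 + 38) / (3 * ln 2)"
    by (simp add: log_def field_simps)
  then show "ereal (r1 + r2) \<le> ereal (4 / 3 * log 2 P + (4 * ln 2 + 38) / (3 * ln 2))" by simp
qed

text \<open>The excess of the bound over 4/3 log P is a constant, which division by log P removes.
  The model is arbitrary, so one lemma serves all four.\<close>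

lemma dof_le: "dof m \<le> 4 / 3"
proof -
  define D :: real where "D = (4 * ln 2 + 38) / (3 * ln 2)"
  have "dof m \<le> Limsup at_top (\<lambda>P. ereal (4 / 3 + D / log 2 P))"
    unfolding dof_def
  proof (rule Limsup_mono, rule eventually_mono[OF eventually_gt_at_top[of 1]])
    fix P :: real assume P: "P > 1"
    then have l: "log 2 P > 0" by simp
    have "C_sum m P / ereal (log 2 P) \<le> ereal (4 / 3 * log 2 P + D) / ereal (log 2 P)"
      using C_sum_bound[of P m] P l unfolding D_def by (intro ereal_divide_right_mono) auto
    also have "\<dots> = ereal (4 / 3 + D / log 2 P)"
      using l by (simp add: add_divide_distrib)
    finally show "C_sum m P / ereal (log 2 P) \<le> ereal (4 / 3 + D / log 2 P)" .
  qed
  also have "\<dots> = ereal (4 / 3)"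
  proof (rule lim_imp_Limsup)
    have "((\<lambda>P. (D * ln 2) / ln P) \<longlongrightarrow> 0) at_top"
      by (intro tendsto_divide_0[OF tendsto_const] filterlim_at_top_imp_at_infinity ln_at_top)
    then have "((\<lambda>P. D / log 2 P) \<longlongrightarrow> 0) at_top"
      by (simp add: log_def)
    from tendsto_add[OF tendsto_const this, of "4/3"]
    show "((\<lambda>P. ereal (4 / 3 + D / log 2 P)) \<longlongrightarrow> ereal (4 / 3)) at_top" by simp
  qed simp
  also have "ereal (4 / 3) = 4 / 3"
    by (simp add: numeral_eq_ereal)
  finally show ?thesis .
qed

theorem theorem1:
  shows "dof DelayedCSI \<le> 4/3 \<and> dof OutputFB \<le> 4/3 \<and> dof LimitedShannonFB \<le> 4/3 \<and> dof ShannonFB \<le> 4/3"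
  by (intro conjI dof_le)

end
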